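(* Algorithm A1 (described in the context), with all arithmetic carried out exactly on rational numbers, runs in time polynomial in $m$, the number of vertices of the input graph.
   Context: Algorithm A1 takes as input the adjacency matrix $H=(h_{ik})$ of a graph on vertices $1,\dots,m$. It computes rational $m\times m$ matrices $A_s=(a_{ij}^s)$ and $R_s=(r_{ik}^s)$ by the recurrence: $A_0=I$; $r_{ik}^0=\tfrac12$ for $i\neq k$ and $r_{ii}^s=0$ for all $s$; for $i\neq k$ and $s\geq 1$, $r_{ik}^s=-\frac{1}{2}\sum_{c=1}^s r_{ik}^{s-c}\sum_{l=1}^m\sum_{d=0}^c(a_{il}^d-a_{kl}^d)(a_{il}^{c-d}-a_{kl}^{c-d})$; and for $s\geq 0$, $a_{ij}^{s+1}=\frac{1}{2(s+1)(2s+1)}\Big(\sum_{k=1}^m\sum_{p=0}^s(a_{ij}^p-a_{kj}^p)r_{ik}^{s-p}-\sum_{k=1}^m h_{ik}(a_{ij}^s-a_{kj}^s)\Big)$. (These $a^s_{ij}$ are the coefficients of $t^{2s}$ in the power series of the solution of $X''=F_H(X)$, $X(0)=I$, $X'(0)=O$, where $F_H(X)_{ij}=\sum_{k\neq i}(x_{ij}-x_{kj})(\|x_i-x_k\|^{-2}-h_{ik})$.) Step 1: compute $A_s$ for $0\leq s\leq m^2$. Step 2: put vertices $i$ and $j$ into the same class iff for every $s$ with $0\leq s\leq m^2$ the $i$-th and $j$-th rows of $A_s$ are permutation equivalent (i.e. one is obtained from the other by permuting entries). *)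

theory Defs
  imports
    "HOL-Computational_Algebra.Polynomial"
    "HOL-Combinatorics.Permutations"
    "HOL-Library.Monad_Syntax"
begin

section \<open>The input and the recurrence\<close>

text \<open>Vertices are numbered from 0, so the vertex set is \<open>{..<m}\<close>.\<close>

definition adjacency_matrix :: "nat \<Rightarrow> bool list list \<Rightarrow> bool" where
  "adjacency_matrix m H \<longleftrightarrow>
     length H = m \<and> (\<forall>row\<in>set H. length row = m) \<and>
     (\<forall>i<m. \<not> H ! i ! i) \<and> (\<forall>i<m. \<forall>k<m. H ! i ! k = H ! k ! i)"

text \<open>\<open>coeff_A H s i j\<close> and \<open>coeff_R H s i k\<close> are $a_{ij}^s$ and $r_{ik}^s$, as
  exact rational numbers. The order of evaluation is $A_0, R_0, A_1, R_1, \dots$.\<close>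

function coeff_A :: "bool list list \<Rightarrow> nat \<Rightarrow> nat \<Rightarrow> nat \<Rightarrow> rat"
  and coeff_R :: "bool list list \<Rightarrow> nat \<Rightarrow> nat \<Rightarrow> nat \<Rightarrow> rat" where
  "coeff_A H 0 i j = (if i = j then 1 else 0)"
| "coeff_A H (Suc s) i j =
     1 / (2 * (of_nat s + 1) * (2 * of_nat s + 1)) *
       ((\<Sum>k<length H. \<Sum>p\<in>{0..s}. (coeff_A H p i j - coeff_A H p k j) * coeff_R H (s - p) i k)
        - (\<Sum>k<length H. of_bool (H ! i ! k) * (coeff_A H s i j - coeff_A H s k j)))"
| "coeff_R H s i k =
     (if i = k then 0
      else if s = 0 then 1 / 2
      else - (1 / 2) * (\<Sum>c\<in>{1..s}. coeff_R H (s - c) i k *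
             (\<Sum>l<length H. \<Sum>d\<in>{0..c}.
                (coeff_A H d i l - coeff_A H d k l) *
                (coeff_A H (c - d) i l - coeff_A H (c - d) k l))))"
  by pat_completeness auto
termination
  by (relation "measure (\<lambda>x. case x of Inl (_, s, _, _) \<Rightarrow> 2 * s | Inr (_, s, _, _) \<Rightarrow> 2 * s + 1)")
     auto

definition rows_perm_equiv :: "bool list list \<Rightarrow> nat \<Rightarrow> nat \<Rightarrow> nat \<Rightarrow> bool" where
  "rows_perm_equiv H s i j \<longleftrightarrow>
     (\<exists>\<pi>. \<pi> permutes {..<length H} \<and> (\<forall>l<length H. coeff_A H s j l = coeff_A H s i (\<pi> l)))"

definition same_class_rel :: "bool list list \<Rightarrow> (nat \<times> nat) set" where
  "same_class_rel H =
     {(i, j). i < length H \<and> j < length H \<and> (\<forall>s \<le> (length H)\<^sup>2. rows_perm_equiv H s i j)}"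


section \<open>Computations with a running time\<close>

text \<open>Algorithm A1 is implemented below as a functional program that counts its own steps: a
  value of type \<open>'a tm\<close> is the result of a computation together with its running time.
  Every function that contributes to the algorithm ticks once per (recursive) call, and apart
  from calling other such functions it uses only operations of constant cost: applying and
  matching the constructors of \<open>bool\<close>, \<open>nat\<close>, \<open>num\<close>, lists, pairs, options and \<open>bint\<close>
  (and selecting a branch). No arithmetic operation is primitive: indices and loop counters are
  unary (constructors \<open>0\<close> and \<open>Suc\<close>), the entries of the matrices are fractions of binary
  integers, and all arithmetic on them is carried out bit by bit. Up to a constant factor the
  time is therefore the number of bit operations and pointer manipulations.\<close>

datatype 'a tm = TM (val: 'a) (time: nat)

definition bind_tm :: "'a tm \<Rightarrow> ('a \<Rightarrow> 'b tm) \<Rightarrow> 'b tm" where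
  "bind_tm p f = (case p of TM x s \<Rightarrow> case f x of TM y t \<Rightarrow> TM y (s + t))"

adhoc_overloading Monad_Syntax.bind \<rightleftharpoons> bind_tm

definition return :: "'a \<Rightarrow> 'a tm" where
  "return x = TM x 0"

definition tick :: "unit tm" where
  "tick = TM () 1"

lemma bind_tm_cong [fundef_cong]:
  assumes "p = q" and "\<And>x. x = val q \<Longrightarrow> f x = g x"
  shows "bind_tm p f = bind_tm q g"
  using assms by (cases q) (simp add: bind_tm_def)

lemma val_simps [simp]:
  "val (bind_tm p f) = val (f (val p))" "val (return x) = x" "val tick = ()"
  by (simp_all add: bind_tm_def return_def tick_def split: tm.split)

lemma time_simps [simp]:
  "time (bind_tm p f) = time p + time (f (val p))" "time (return x) = 0" "time tick = 1"
  by (simp_all add: bind_tm_def return_def tick_def split: tm.split)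


section \<open>Natural numbers in unary and lists\<close>

fun eq_nat_tm :: "nat \<Rightarrow> nat \<Rightarrow> bool tm" where
  "eq_nat_tm 0 0 = do { tick; return True }"
| "eq_nat_tm (Suc x) (Suc y) = do { tick; eq_nat_tm x y }"
| "eq_nat_tm _ _ = do { tick; return False }"

fun add_nat_tm :: "nat \<Rightarrow> nat \<Rightarrow> nat tm" where
  "add_nat_tm 0 y = do { tick; return y }"
| "add_nat_tm (Suc x) y = do { tick; add_nat_tm x (Suc y) }"

fun mult_nat_tm :: "nat \<Rightarrow> nat \<Rightarrow> nat tm" where
  "mult_nat_tm 0 y = do { tick; return 0 }"
| "mult_nat_tm (Suc x) y = do { tick; z \<leftarrow> mult_nat_tm x y; add_nat_tm y z }"

fun minus_nat_tm :: "nat \<Rightarrow> nat \<Rightarrow> nat tm" where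
  "minus_nat_tm x 0 = do { tick; return x }"
| "minus_nat_tm 0 (Suc y) = do { tick; return 0 }"
| "minus_nat_tm (Suc x) (Suc y) = do { tick; minus_nat_tm x y }"

text \<open>\<open>range_tm a n\<close> computes \<open>[a..<a + n]\<close>.\<close>

fun range_tm :: "nat \<Rightarrow> nat \<Rightarrow> nat list tm" where
  "range_tm a 0 = do { tick; return [] }"
| "range_tm a (Suc n) = do { tick; xs \<leftarrow> range_tm (Suc a) n; return (a # xs) }"

fun length_tm :: "'a list \<Rightarrow> nat tm" where
  "length_tm [] = do { tick; return 0 }"
| "length_tm (x # xs) = do { tick; n \<leftarrow> length_tm xs; return (Suc n) }"

fun nth_tm :: "'a list \<Rightarrow> nat \<Rightarrow> 'a tm" where
  "nth_tm [] n = do { tick; return undefined }"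
| "nth_tm (x # xs) 0 = do { tick; return x }"
| "nth_tm (x # xs) (Suc n) = do { tick; nth_tm xs n }"

fun snoc_tm :: "'a list \<Rightarrow> 'a \<Rightarrow> 'a list tm" where
  "snoc_tm [] y = do { tick; return [y] }"
| "snoc_tm (x # xs) y = do { tick; zs \<leftarrow> snoc_tm xs y; return (x # zs) }"

fun map_tm :: "('a \<Rightarrow> 'b tm) \<Rightarrow> 'a list \<Rightarrow> 'b list tm" where
  "map_tm f [] = do { tick; return [] }"
| "map_tm f (x # xs) = do { tick; y \<leftarrow> f x; ys \<leftarrow> map_tm f xs; return (y # ys) }"


section \<open>Binary arithmetic\<close>

text \<open>Positive integers are elements of the library type \<open>num\<close>, i.e. binary numerals with the
  least significant bit outermost. The equations for addition, multiplication and subtraction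
  are those of the corresponding operations of theory \<open>Num\<close>.\<close>

fun inc_tm :: "num \<Rightarrow> num tm" where
  "inc_tm num.One = do { tick; return (num.Bit0 num.One) }"
| "inc_tm (num.Bit0 x) = do { tick; return (num.Bit1 x) }"
| "inc_tm (num.Bit1 x) = do { tick; y \<leftarrow> inc_tm x; return (num.Bit0 y) }"

text \<open>\<open>dbl_minus_one_tm x\<close> computes $2x - 1$.\<close>

fun dbl_minus_one_tm :: "num \<Rightarrow> num tm" where
  "dbl_minus_one_tm num.One = do { tick; return num.One }"
| "dbl_minus_one_tm (num.Bit0 x) = do { tick; y \<leftarrow> dbl_minus_one_tm x; return (num.Bit1 y) }"
| "dbl_minus_one_tm (num.Bit1 x) = do { tick; return (num.Bit1 (num.Bit0 x)) }"

fun add_num_tm :: "num \<Rightarrow> num \<Rightarrow> num tm" where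
  "add_num_tm num.One y = do { tick; inc_tm y }"
| "add_num_tm x num.One = do { tick; inc_tm x }"
| "add_num_tm (num.Bit0 x) (num.Bit0 y) = do { tick; z \<leftarrow> add_num_tm x y; return (num.Bit0 z) }"
| "add_num_tm (num.Bit0 x) (num.Bit1 y) = do { tick; z \<leftarrow> add_num_tm x y; return (num.Bit1 z) }"
| "add_num_tm (num.Bit1 x) (num.Bit0 y) = do { tick; z \<leftarrow> add_num_tm x y; return (num.Bit1 z) }"
| "add_num_tm (num.Bit1 x) (num.Bit1 y) =
     do { tick; z \<leftarrow> add_num_tm x y; w \<leftarrow> inc_tm z; return (num.Bit0 w) }"

fun mult_num_tm :: "num \<Rightarrow> num \<Rightarrow> num tm" where
  "mult_num_tm x num.One = do { tick; return x }"
| "mult_num_tm x (num.Bit0 y) = do { tick; z \<leftarrow> mult_num_tm x y; return (num.Bit0 z) }"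
| "mult_num_tm x (num.Bit1 y) = do { tick; z \<leftarrow> mult_num_tm x y; add_num_tm (num.Bit0 z) x }"

datatype bint = BZero | BPos num | BNeg num

fun dbl_tm :: "bint \<Rightarrow> bint tm" where
  "dbl_tm BZero = do { tick; return BZero }"
| "dbl_tm (BPos x) = do { tick; return (BPos (num.Bit0 x)) }"
| "dbl_tm (BNeg x) = do { tick; return (BNeg (num.Bit0 x)) }"

fun dbl_inc_tm :: "bint \<Rightarrow> bint tm" where
  "dbl_inc_tm BZero = do { tick; return (BPos num.One) }"
| "dbl_inc_tm (BPos x) = do { tick; return (BPos (num.Bit1 x)) }"
| "dbl_inc_tm (BNeg x) = do { tick; y \<leftarrow> dbl_minus_one_tm x; return (BNeg y) }"

fun dbl_dec_tm :: "bint \<Rightarrow> bint tm" where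
  "dbl_dec_tm BZero = do { tick; return (BNeg num.One) }"
| "dbl_dec_tm (BPos x) = do { tick; y \<leftarrow> dbl_minus_one_tm x; return (BPos y) }"
| "dbl_dec_tm (BNeg x) = do { tick; return (BNeg (num.Bit1 x)) }"

fun sub_num_tm :: "num \<Rightarrow> num \<Rightarrow> bint tm" where
  "sub_num_tm num.One num.One = do { tick; return BZero }"
| "sub_num_tm (num.Bit0 x) num.One = do { tick; z \<leftarrow> dbl_minus_one_tm x; return (BPos z) }"
| "sub_num_tm (num.Bit1 x) num.One = do { tick; return (BPos (num.Bit0 x)) }"
| "sub_num_tm num.One (num.Bit0 y) = do { tick; z \<leftarrow> dbl_minus_one_tm y; return (BNeg z) }"
| "sub_num_tm num.One (num.Bit1 y) = do { tick; return (BNeg (num.Bit0 y)) }"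
| "sub_num_tm (num.Bit0 x) (num.Bit0 y) = do { tick; d \<leftarrow> sub_num_tm x y; dbl_tm d }"
| "sub_num_tm (num.Bit1 x) (num.Bit1 y) = do { tick; d \<leftarrow> sub_num_tm x y; dbl_tm d }"
| "sub_num_tm (num.Bit1 x) (num.Bit0 y) = do { tick; d \<leftarrow> sub_num_tm x y; dbl_inc_tm d }"
| "sub_num_tm (num.Bit0 x) (num.Bit1 y) = do { tick; d \<leftarrow> sub_num_tm x y; dbl_dec_tm d }"

fun neg_int_tm :: "bint \<Rightarrow> bint tm" where
  "neg_int_tm BZero = do { tick; return BZero }"
| "neg_int_tm (BPos x) = do { tick; return (BNeg x) }"
| "neg_int_tm (BNeg x) = do { tick; return (BPos x) }"

fun add_int_tm :: "bint \<Rightarrow> bint \<Rightarrow> bint tm" where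
  "add_int_tm BZero b = do { tick; return b }"
| "add_int_tm a BZero = do { tick; return a }"
| "add_int_tm (BPos x) (BPos y) = do { tick; z \<leftarrow> add_num_tm x y; return (BPos z) }"
| "add_int_tm (BNeg x) (BNeg y) = do { tick; z \<leftarrow> add_num_tm x y; return (BNeg z) }"
| "add_int_tm (BPos x) (BNeg y) = do { tick; sub_num_tm x y }"
| "add_int_tm (BNeg x) (BPos y) = do { tick; sub_num_tm y x }"

fun mult_int_tm :: "bint \<Rightarrow> bint \<Rightarrow> bint tm" where
  "mult_int_tm BZero b = do { tick; return BZero }"
| "mult_int_tm a BZero = do { tick; return BZero }"
| "mult_int_tm (BPos x) (BPos y) = do { tick; z \<leftarrow> mult_num_tm x y; return (BPos z) }"
| "mult_int_tm (BNeg x) (BNeg y) = do { tick; z \<leftarrow> mult_num_tm x y; return (BPos z) }"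
| "mult_int_tm (BPos x) (BNeg y) = do { tick; z \<leftarrow> mult_num_tm x y; return (BNeg z) }"
| "mult_int_tm (BNeg x) (BPos y) = do { tick; z \<leftarrow> mult_num_tm x y; return (BNeg z) }"

text \<open>Long division. \<open>div_step_tm g q r\<close> completes a step with divisor \<open>g\<close>: \<open>q\<close> is the quotient
  found so far and \<open>r\<close> the remainder with the next bit of the dividend appended.\<close>

definition div_step_tm :: "num \<Rightarrow> bint \<Rightarrow> bint \<Rightarrow> (bint \<times> bint) tm" where
  "div_step_tm g q r = do {
     tick;
     d \<leftarrow> add_int_tm r (BNeg g);
     (case d of
        BNeg _ \<Rightarrow> do { q' \<leftarrow> dbl_tm q; return (q', r) }
      | _ \<Rightarrow> do { q' \<leftarrow> dbl_inc_tm q; return (q', d) }) }"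

fun divmod_num_tm :: "num \<Rightarrow> num \<Rightarrow> (bint \<times> bint) tm" where
  "divmod_num_tm num.One g = do { tick; div_step_tm g BZero (BPos num.One) }"
| "divmod_num_tm (num.Bit0 x) g =
     do { tick; (q, r) \<leftarrow> divmod_num_tm x g; r' \<leftarrow> dbl_tm r; div_step_tm g q r' }"
| "divmod_num_tm (num.Bit1 x) g =
     do { tick; (q, r) \<leftarrow> divmod_num_tm x g; r' \<leftarrow> dbl_inc_tm r; div_step_tm g q r' }"

text \<open>\<open>div_num_tm x g\<close> is only used when \<open>g\<close> divides \<open>x\<close>, so the quotient is positive.\<close>

definition div_num_tm :: "num \<Rightarrow> num \<Rightarrow> num tm" where
  "div_num_tm x g =
     do { tick; (q, r) \<leftarrow> divmod_num_tm x g; return (case q of BPos y \<Rightarrow> y | _ \<Rightarrow> num.One) }"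

lemma size_dbl_minus_one: "size (val (dbl_minus_one_tm x)) \<le> Suc (size x)"
  by (induction x rule: dbl_minus_one_tm.induct) auto

lemma size_sub_num:
  "case val (sub_num_tm x y) of
     BZero \<Rightarrow> True | BPos d \<Rightarrow> size d \<le> size x | BNeg d \<Rightarrow> size d \<le> size y"
proof (induction x y rule: sub_num_tm.induct)
  case (8 x y)
  then show ?case
    using size_dbl_minus_one order_trans by (fastforce split: bint.splits)
next
  case (9 x y)
  then show ?case
    using size_dbl_minus_one order_trans by (fastforce split: bint.splits)
qed (auto split: bint.splits simp: size_dbl_minus_one)

function gcd_num_tm :: "num \<Rightarrow> num \<Rightarrow> num tm" where
  "gcd_num_tm num.One y = do { tick; return num.One }"
| "gcd_num_tm (num.Bit0 x) num.One = do { tick; return num.One }"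
| "gcd_num_tm (num.Bit1 x) num.One = do { tick; return num.One }"
| "gcd_num_tm (num.Bit0 x) (num.Bit0 y) = do { tick; g \<leftarrow> gcd_num_tm x y; return (num.Bit0 g) }"
| "gcd_num_tm (num.Bit0 x) (num.Bit1 y) = do { tick; gcd_num_tm x (num.Bit1 y) }"
| "gcd_num_tm (num.Bit1 x) (num.Bit0 y) = do { tick; gcd_num_tm (num.Bit1 x) y }"
| "gcd_num_tm (num.Bit1 x) (num.Bit1 y) = do {
     tick;
     d \<leftarrow> sub_num_tm x y;
     (case d of
        BZero \<Rightarrow> return (num.Bit1 x)
      | BPos z \<Rightarrow> gcd_num_tm z (num.Bit1 y)
      | BNeg z \<Rightarrow> gcd_num_tm (num.Bit1 x) z) }"
  by pat_completeness auto
termination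
proof (relation "measure (\<lambda>(x, y). size x + size y)", goal_cases)
  case (5 x y d z)
  then show ?case using size_sub_num[of x y] by (auto split: bint.splits)
next
  case (6 x y d z)
  then show ?case using size_sub_num[of x y] by (auto split: bint.splits)
qed auto


section \<open>Exact rational arithmetic\<close>

text \<open>A rational number is a fraction in lowest terms with positive denominator; in
  particular zero is \<open>(BZero, One)\<close>, and equal numbers have equal representations.\<close>

type_synonym brat = "bint \<times> num"

fun int_of_bint :: "bint \<Rightarrow> int" where
  "int_of_bint BZero = 0"
| "int_of_bint (BPos x) = numeral x"
| "int_of_bint (BNeg x) = - numeral x"

definition rat_of_brat :: "brat \<Rightarrow> rat" where
  "rat_of_brat q = of_int (int_of_bint (fst q)) / numeral (snd q)"

fun reduce_tm :: "bint \<Rightarrow> num \<Rightarrow> brat tm" where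
  "reduce_tm BZero d = do { tick; return (BZero, num.One) }"
| "reduce_tm (BPos x) d =
     do { tick; g \<leftarrow> gcd_num_tm x d; x' \<leftarrow> div_num_tm x g; d' \<leftarrow> div_num_tm d g;
          return (BPos x', d') }"
| "reduce_tm (BNeg x) d =
     do { tick; g \<leftarrow> gcd_num_tm x d; x' \<leftarrow> div_num_tm x g; d' \<leftarrow> div_num_tm d g;
          return (BNeg x', d') }"

fun add_rat_tm :: "brat \<Rightarrow> brat \<Rightarrow> brat tm" where
  "add_rat_tm (a, b) (c, d) =
     do { tick; x \<leftarrow> mult_int_tm a (BPos d); y \<leftarrow> mult_int_tm c (BPos b); z \<leftarrow> add_int_tm x y;
          w \<leftarrow> mult_num_tm b d; reduce_tm z w }"

fun sub_rat_tm :: "brat \<Rightarrow> brat \<Rightarrow> brat tm" where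
  "sub_rat_tm p (c, d) = do { tick; c' \<leftarrow> neg_int_tm c; add_rat_tm p (c', d) }"

fun mult_rat_tm :: "brat \<Rightarrow> brat \<Rightarrow> brat tm" where
  "mult_rat_tm (a, b) (c, d) =
     do { tick; x \<leftarrow> mult_int_tm a c; y \<leftarrow> mult_num_tm b d; reduce_tm x y }"

fun sum_tm :: "('a \<Rightarrow> brat tm) \<Rightarrow> 'a list \<Rightarrow> brat tm" where
  "sum_tm f [] = do { tick; return (BZero, num.One) }"
| "sum_tm f (x # xs) = do { tick; y \<leftarrow> f x; z \<leftarrow> sum_tm f xs; add_rat_tm y z }"

fun eq_num_tm :: "num \<Rightarrow> num \<Rightarrow> bool tm" where
  "eq_num_tm num.One num.One = do { tick; return True }"
| "eq_num_tm (num.Bit0 x) (num.Bit0 y) = do { tick; eq_num_tm x y }"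
| "eq_num_tm (num.Bit1 x) (num.Bit1 y) = do { tick; eq_num_tm x y }"
| "eq_num_tm _ _ = do { tick; return False }"

fun eq_int_tm :: "bint \<Rightarrow> bint \<Rightarrow> bool tm" where
  "eq_int_tm BZero BZero = do { tick; return True }"
| "eq_int_tm (BPos x) (BPos y) = do { tick; eq_num_tm x y }"
| "eq_int_tm (BNeg x) (BNeg y) = do { tick; eq_num_tm x y }"
| "eq_int_tm _ _ = do { tick; return False }"

fun eq_rat_tm :: "brat \<Rightarrow> brat \<Rightarrow> bool tm" where
  "eq_rat_tm (a, b) (c, d) =
     do { tick; e \<leftarrow> eq_int_tm a c; if e then eq_num_tm b d else return False }"

text \<open>\<open>num_of_Suc_tm n\<close> computes the binary numeral of \<open>n + 1\<close>.\<close>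

fun num_of_Suc_tm :: "nat \<Rightarrow> num tm" where
  "num_of_Suc_tm 0 = do { tick; return num.One }"
| "num_of_Suc_tm (Suc n) = do { tick; x \<leftarrow> num_of_Suc_tm n; inc_tm x }"


section \<open>Step 1: the matrices\<close>

type_synonym bmatrix = "brat list list"

definition matrix_tm :: "nat \<Rightarrow> (nat \<Rightarrow> nat \<Rightarrow> brat tm) \<Rightarrow> bmatrix tm" where
  "matrix_tm m f = do { tick; is \<leftarrow> range_tm 0 m; map_tm (\<lambda>i. map_tm (\<lambda>j. f i j) is) is }"

text \<open>\<open>entry_tm Ms s i j\<close> looks up entry \<open>(i, j)\<close> of the \<open>s\<close>-th matrix of a list of matrices, and
  \<open>diff_tm As s i k j\<close> computes $a_{ij}^s - a_{kj}^s$.\<close>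

definition entry_tm :: "bmatrix list \<Rightarrow> nat \<Rightarrow> nat \<Rightarrow> nat \<Rightarrow> brat tm" where
  "entry_tm Ms s i j = do { tick; M \<leftarrow> nth_tm Ms s; row \<leftarrow> nth_tm M i; nth_tm row j }"

definition diff_tm :: "bmatrix list \<Rightarrow> nat \<Rightarrow> nat \<Rightarrow> nat \<Rightarrow> nat \<Rightarrow> brat tm" where
  "diff_tm As s i k j =
     do { tick; x \<leftarrow> entry_tm As s i j; y \<leftarrow> entry_tm As s k j; sub_rat_tm x y }"

text \<open>$\sum_l \sum_{d=0}^c (a_{il}^d - a_{kl}^d)(a_{il}^{c-d} - a_{kl}^{c-d})$\<close>

definition dist_coeff_tm :: "bmatrix list \<Rightarrow> nat \<Rightarrow> nat \<Rightarrow> nat \<Rightarrow> nat \<Rightarrow> brat tm" where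
  "dist_coeff_tm As m c i k = do {
     tick;
     ls \<leftarrow> range_tm 0 m;
     ds \<leftarrow> range_tm 0 (Suc c);
     sum_tm (\<lambda>l. sum_tm (\<lambda>d. do {
       x \<leftarrow> diff_tm As d i k l;
       c' \<leftarrow> minus_nat_tm c d;
       y \<leftarrow> diff_tm As c' i k l;
       mult_rat_tm x y }) ds) ls }"

text \<open>\<open>R_entry_tm As Rs m s i k\<close> computes $r_{ik}^s$ from \<open>As\<close> $= [A_0, \dots, A_s]$ and
  \<open>Rs\<close> $= [R_0, \dots, R_{s-1}]$.\<close>

definition R_entry_tm ::
  "bmatrix list \<Rightarrow> bmatrix list \<Rightarrow> nat \<Rightarrow> nat \<Rightarrow> nat \<Rightarrow> nat \<Rightarrow> brat tm" where
  "R_entry_tm As Rs m s i k = do {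
     tick;
     e \<leftarrow> eq_nat_tm i k;
     if e then return (BZero, num.One)
     else (case s of
        0 \<Rightarrow> return (BPos num.One, num.Bit0 num.One)
      | Suc _ \<Rightarrow> do {
          cs \<leftarrow> range_tm (Suc 0) s;
          x \<leftarrow> sum_tm (\<lambda>c. do {
            c' \<leftarrow> minus_nat_tm s c;
            r \<leftarrow> entry_tm Rs c' i k;
            w \<leftarrow> dist_coeff_tm As m c i k;
            mult_rat_tm r w }) cs;
          mult_rat_tm (BNeg num.One, num.Bit0 num.One) x }) }"

text \<open>\<open>factor_tm s\<close> computes $\frac{1}{2(s+1)(2s+1)}$.\<close>

definition factor_tm :: "nat \<Rightarrow> brat tm" where
  "factor_tm s = do {
     tick;
     x \<leftarrow> num_of_Suc_tm s;
     s2 \<leftarrow> add_nat_tm s s;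
     y \<leftarrow> num_of_Suc_tm s2;
     z \<leftarrow> mult_num_tm (num.Bit0 x) y;
     return (BPos num.One, z) }"

text \<open>\<open>A_entry_tm H As Rs m s i j\<close> computes $a_{ij}^{s+1}$ from \<open>As\<close> $= [A_0, \dots, A_s]$ and
  \<open>Rs\<close> $= [R_0, \dots, R_s]$.\<close>

definition A_entry_tm ::
  "bool list list \<Rightarrow> bmatrix list \<Rightarrow> bmatrix list \<Rightarrow> nat \<Rightarrow> nat \<Rightarrow> nat \<Rightarrow> nat \<Rightarrow> brat tm" where
  "A_entry_tm H As Rs m s i j = do {
     tick;
     ks \<leftarrow> range_tm 0 m;
     ps \<leftarrow> range_tm 0 (Suc s);
     x \<leftarrow> sum_tm (\<lambda>k. sum_tm (\<lambda>p. do {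
            u \<leftarrow> diff_tm As p i k j;
            p' \<leftarrow> minus_nat_tm s p;
            r \<leftarrow> entry_tm Rs p' i k;
            mult_rat_tm u r }) ps) ks;
     y \<leftarrow> sum_tm (\<lambda>k. do {
            row \<leftarrow> nth_tm H i;
            h \<leftarrow> nth_tm row k;
            u \<leftarrow> diff_tm As s i k j;
            mult_rat_tm (if h then BPos num.One else BZero, num.One) u }) ks;
     z \<leftarrow> sub_rat_tm x y;
     f \<leftarrow> factor_tm s;
     mult_rat_tm f z }"

text \<open>\<open>tables_tm H m s\<close> computes $[A_0, \dots, A_s]$ and $[R_0, \dots, R_{s-1}]$.\<close>

fun tables_tm :: "bool list list \<Rightarrow> nat \<Rightarrow> nat \<Rightarrow> (bmatrix list \<times> bmatrix list) tm" where
  "tables_tm H m 0 = do {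
     tick;
     A \<leftarrow> matrix_tm m (\<lambda>i j. do {
            e \<leftarrow> eq_nat_tm i j;
            return (if e then BPos num.One else BZero, num.One) });
     return ([A], []) }"
| "tables_tm H m (Suc s) = do {
     tick;
     (As, Rs) \<leftarrow> tables_tm H m s;
     R \<leftarrow> matrix_tm m (R_entry_tm As Rs m s);
     Rs' \<leftarrow> snoc_tm Rs R;
     A \<leftarrow> matrix_tm m (A_entry_tm H As Rs' m s);
     As' \<leftarrow> snoc_tm As A;
     return (As', Rs') }"


section \<open>Step 2: the classes\<close>

fun remove_tm :: "brat \<Rightarrow> brat list \<Rightarrow> brat list option tm" where
  "remove_tm x [] = do { tick; return None }"
| "remove_tm x (y # ys) = do {
     tick;
     e \<leftarrow> eq_rat_tm x y;
     if e then return (Some ys)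
     else do {
       zs \<leftarrow> remove_tm x ys;
       return (case zs of None \<Rightarrow> None | Some zs' \<Rightarrow> Some (y # zs')) } }"

fun perm_equiv_tm :: "brat list \<Rightarrow> brat list \<Rightarrow> bool tm" where
  "perm_equiv_tm [] ys = do { tick; return (case ys of [] \<Rightarrow> True | _ \<Rightarrow> False) }"
| "perm_equiv_tm (x # xs) ys = do {
     tick;
     zs \<leftarrow> remove_tm x ys;
     (case zs of None \<Rightarrow> return False | Some zs' \<Rightarrow> perm_equiv_tm xs zs') }"

fun same_class_tm :: "bmatrix list \<Rightarrow> nat \<Rightarrow> nat \<Rightarrow> bool tm" where
  "same_class_tm [] i j = do { tick; return True }"
| "same_class_tm (A # As) i j = do {
     tick;
     xs \<leftarrow> nth_tm A i;
     ys \<leftarrow> nth_tm A j;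
     e \<leftarrow> perm_equiv_tm xs ys;
     if e then same_class_tm As i j else return False }"

text \<open>A vertex is put into the class whose first member is equivalent to it, and into a new class
  if there is none. The classes are never empty lists.\<close>

fun insert_vertex_tm :: "bmatrix list \<Rightarrow> nat \<Rightarrow> nat list list \<Rightarrow> nat list list tm" where
  "insert_vertex_tm As i [] = do { tick; return [[i]] }"
| "insert_vertex_tm As i ([] # Cs) = do { tick; insert_vertex_tm As i Cs }"
| "insert_vertex_tm As i ((j # C) # Cs) = do {
     tick;
     e \<leftarrow> same_class_tm As i j;
     if e then return ((j # i # C) # Cs)
     else do { Cs' \<leftarrow> insert_vertex_tm As i Cs; return ((j # C) # Cs') } }"

fun classes_tm :: "bmatrix list \<Rightarrow> nat list \<Rightarrow> nat list list tm" where
  "classes_tm As [] = do { tick; return [] }"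
| "classes_tm As (i # is) =
     do { tick; Cs \<leftarrow> classes_tm As is; insert_vertex_tm As i Cs }"


section \<open>The algorithm\<close>

definition algorithm_A1 :: "bool list list \<Rightarrow> (bmatrix list \<times> nat list list) tm" where
  "algorithm_A1 H = do {
     tick;
     m \<leftarrow> length_tm H;
     N \<leftarrow> mult_nat_tm m m;
     (As, Rs) \<leftarrow> tables_tm H m N;
     is \<leftarrow> range_tm 0 m;
     Cs \<leftarrow> classes_tm As is;
     return (As, Cs) }"

text \<open>\<open>output_A1 m H (As, Cs)\<close> says that \<open>As\<close> lists the exact matrices $A_0, \dots, A_{m^2}$ and that
  \<open>Cs\<close> lists the classes of vertices, every vertex occurring exactly once.\<close>

definition output_A1 :: "nat \<Rightarrow> bool list list \<Rightarrow> bmatrix list \<times> nat list list \<Rightarrow> bool" where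
  "output_A1 m H = (\<lambda>(As, Cs).
     map (map (map rat_of_brat)) As =
       map (\<lambda>s. map (\<lambda>i. map (\<lambda>j. coeff_A H s i j) [0..<m]) [0..<m]) [0..<m\<^sup>2 + 1] \<and>
     set ` set Cs = {..<m} // same_class_rel H \<and> distinct (concat Cs))"

end

theory Submission
  imports Defs
begin

text \<open>The numbers $4^s (2s)!\,a_{ij}^s$ and $2 \cdot 4^s (2s)!\,r_{ik}^s$ are integers, and by induction
  $|a_{ij}^s|$ and $|r_{ik}^s|$ are at most $K^{2s}$ for $s \le N$, where $K = 2(m+1)(N+1)^2$. For
  $N = m^2$ the reduced fractions therefore have numerators and denominators of polynomially many
  bits. The intermediate results in the evaluation of one entry come from these by polynomially
  many additions and multiplications, and a sum or a product of two fractions whose terms are at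
  most $2^b$ and $2^c$ has a representation with terms at most $2^{b+c+1}$. So every operation acts on
  numbers of polynomial length, and each of them takes polynomial time in this length.\<close>

text \<open>The danger is compounding. An operation on fractions may add the lengths of its
  operands, and the result of one stage of the recurrence enters all later stages, so lengths
  estimated along the whole computation would grow exponentially with the number of stages. Hence
  the length of a stored entry is never derived from the way it was computed. It comes from a bound
  on the rational number itself, proved from the recurrence alone, and it carries over to the
  program because a fraction in lowest terms is no longer than any other fraction for the same
  number. Estimates along the computation are made only within one entry, which starts afresh from
  stored entries. Common denominators exist because the recurrences are convolutions: products of
  factorials divide the factorial of the sum of the indices. The base \<open>K\<close> dominates the
  number of terms of such a convolution times its constant factors.\<close>

text \<open>The semantics of binary numerals is expressed with \<open>nat_of_num\<close> rather than \<open>numeral\<close>, because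
  rewriting with the equations for \<open>numeral (num.Bit0 x)\<close> would also expand the literal 2, and loop.\<close>

declare int_of_bint.simps [simp del]

section \<open>Bit length against magnitude\<close>

lemma int_of_bint_simps [simp]:
  "int_of_bint BZero = 0"
  "int_of_bint (BPos x) = int (nat_of_num x)"
  "int_of_bint (BNeg x) = - int (nat_of_num x)"
  by (simp_all add: int_of_bint.simps nat_of_num_numeral)

lemma nat_of_num_BitM [simp]: "int (nat_of_num (Num.BitM x)) = 2 * int (nat_of_num x) - 1"
  by (induction x) auto

declare nat_of_num_pos [simp] nat_of_num_add [simp] nat_of_num_mult [simp]

text \<open>\<open>size\<close> counts the constructors above \<open>num.One\<close>, so it is the
  integer part of the binary logarithm, one less than the number of bits.\<close>

lemma num_size_bounds: "2 ^ size x \<le> nat_of_num x" "nat_of_num x < 2 ^ Suc (size x)"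
  by (induction x) auto

text \<open>Lengths of results are bounded through their values: an arithmetic inequality replaces
  an induction over the program.\<close>

lemma size_num_le:
  assumes "nat_of_num x < 2 ^ Suc k"
  shows "size x \<le> k"
proof -
  have "(2::nat) ^ size x < 2 ^ Suc k"
    using num_size_bounds(1)[of x] assms by linarith
  then have "size x < Suc k"
    by (rule power_less_imp_less_exp[rotated]) simp
  then show ?thesis by simp
qed

fun isize :: "bint \<Rightarrow> nat" where
  "isize BZero = 0"
| "isize (BPos x) = size x"
| "isize (BNeg x) = size x"

lemma isize_le:
  assumes "\<bar>int_of_bint b\<bar> < 2 ^ Suc k"
  shows "isize b \<le> k"
proof -
  have "size x \<le> k" if "int (nat_of_num x) < 2 ^ Suc k" for x
    by (rule size_num_le, subst of_nat_less_iff[symmetric, where 'a = int]) (use that in simp)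
  then show ?thesis
    using assms by (cases b) auto
qed

lemma int_num_less: "int (nat_of_num x) < 2 ^ Suc (size x)"
  using num_size_bounds(2)[of x] by (subst (asm) of_nat_less_iff[symmetric, where 'a = int]) simp

lemma int_of_bint_bound: "\<bar>int_of_bint b\<bar> < 2 ^ Suc (isize b)"
  using int_num_less by (cases b) auto

section \<open>Addition, subtraction and multiplication of binary integers\<close>

lemma val_inc [simp]: "val (inc_tm x) = Num.inc x"
  by (induction x) auto

lemma time_inc: "time (inc_tm x) \<le> Suc (size x)"
  by (induction x) auto

lemma val_dbl_minus_one [simp]: "val (dbl_minus_one_tm x) = Num.BitM x"
  by (induction x) auto

lemma time_dbl_minus_one: "time (dbl_minus_one_tm x) \<le> Suc (size x)"
  by (induction x) auto

lemma val_add_num [simp]: "val (add_num_tm x y) = x + y"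
  by (induction x y rule: add_num_tm.induct) (auto simp: add_One add_One_commute)

lemma size_add_num: "size (x + y :: num) \<le> Suc (max (size x) (size y))"
proof (rule size_num_le)
  have "nat_of_num x < 2 ^ Suc (max (size x) (size y))"
    by (rule less_le_trans[OF num_size_bounds(2)]) (simp add: power_increasing)
  moreover have "nat_of_num y < 2 ^ Suc (max (size x) (size y))"
    by (rule less_le_trans[OF num_size_bounds(2)]) (simp add: power_increasing)
  ultimately show "nat_of_num (x + y) < 2 ^ Suc (Suc (max (size x) (size y)))"
    by simp
qed

text \<open>When both lowest bits are 1, the carry is a separate pass of \<open>inc_tm\<close> over
  the sum of the remaining bits. Each level may thus add a linear cost, which gives a quadratic
  bound.\<close>

lemma time_add_num: "time (add_num_tm x y) \<le> (size x + size y + 2)\<^sup>2"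
proof (induction x y rule: add_num_tm.induct)
  case (1 y)
  then show ?case using time_inc[of y] by (simp add: power2_eq_square)
next
  case ("2_1" x)
  then show ?case using time_inc[of x] by (simp add: power2_eq_square)
next
  case ("2_2" x)
  then show ?case using time_inc[of x] by (simp add: power2_eq_square)
next
  case (6 x y)
  have "time (inc_tm (x + y)) \<le> size x + size y + 2"
    using time_inc[of "x + y"] size_add_num[of x y] by linarith
  with 6 show ?case by (simp add: power2_eq_square)
qed (simp_all add: power2_eq_square)

lemma val_mult_num [simp]: "val (mult_num_tm x y) = x * y"
  by (induction x y rule: mult_num_tm.induct) (auto simp: num_eq_iff algebra_simps)

lemma size_mult_num: "size (x * y :: num) \<le> Suc (size x + size y)"
proof (rule size_num_le)
  have "nat_of_num x * nat_of_num y < 2 ^ Suc (size x) * 2 ^ Suc (size y)"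
    by (rule mult_strict_mono) (use num_size_bounds(2) in auto)
  also have "\<dots> = 2 ^ Suc (Suc (size x + size y))"
    by (simp add: power_add)
  finally show "nat_of_num (x * y) < \<dots>"
    by simp
qed

text \<open>Schoolbook multiplication: every bit of \<open>y\<close> costs at most one addition. The
  operands there are twice a partial product, of size at most \<open>size x + size y + 2\<close>,
  and \<open>x\<close>; inserting these sizes into \<open>time_add_num\<close> gives the
  square.\<close>

lemma time_mult_num: "time (mult_num_tm x y) \<le> Suc (size y) * Suc ((2 * size x + size y + 4)\<^sup>2)"
proof (induction x y rule: mult_num_tm.induct)
  case (3 x y)
  define a where "a = Suc ((2 * size x + size y + 4)\<^sup>2)"
  define b where "b = Suc ((2 * size x + Suc (size y) + 4)\<^sup>2)"
  have "a \<le> b" by (simp add: a_def b_def)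
  then have *: "Suc (size y) * a \<le> Suc (size y) * b" by (rule mult_left_mono) simp
  have "time (add_num_tm (num.Bit0 (x * y)) x) \<le> (size (num.Bit0 (x * y)) + size x + 2)\<^sup>2"
    by (rule time_add_num)
  also have "\<dots> \<le> (2 * size x + Suc (size y) + 4)\<^sup>2"
    by (rule power_mono) (use size_mult_num[of x y] in simp_all)
  finally show ?case using 3 * by (simp add: a_def b_def)
next
  case (2 x y)
  define a where "a = Suc ((2 * size x + size y + 4)\<^sup>2)"
  define b where "b = Suc ((2 * size x + Suc (size y) + 4)\<^sup>2)"
  have "a \<le> b" by (simp add: a_def b_def)
  then have *: "Suc (size y) * a \<le> Suc (size y) * b" by (rule mult_left_mono) simp
  show ?case using 2 * by (simp add: a_def b_def)
qed simp

lemma val_dbl [simp]: "int_of_bint (val (dbl_tm a)) = 2 * int_of_bint a"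
  by (cases a) auto

lemma val_dbl_inc [simp]: "int_of_bint (val (dbl_inc_tm a)) = 2 * int_of_bint a + 1"
  by (cases a) auto

lemma val_dbl_dec [simp]: "int_of_bint (val (dbl_dec_tm a)) = 2 * int_of_bint a - 1"
  by (cases a) auto

lemma time_dbl:
  "time (dbl_tm a) \<le> isize a + 2" "time (dbl_inc_tm a) \<le> isize a + 2"
  "time (dbl_dec_tm a) \<le> isize a + 2"
  using time_dbl_minus_one by (cases a; force)+

lemma val_sub_num [simp]: "int_of_bint (val (sub_num_tm x y)) = int (nat_of_num x) - int (nat_of_num y)"
  by (induction x y rule: sub_num_tm.induct)
     auto

text \<open>Each level applies a doubling to the difference found so far, and
  \<open>dbl_minus_one_tm\<close> may traverse all of it; \<open>size_sub_num\<close> bounds its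
  length.\<close>

lemma time_sub_num: "time (sub_num_tm x y) \<le> (size x + size y + 2)\<^sup>2"
proof -
  have d: "isize (val (sub_num_tm x y)) \<le> size x + size y" for x y
    using size_sub_num[of x y] by (auto split: bint.splits)
  show ?thesis
  proof (induction x y rule: sub_num_tm.induct)
    case (2 x)
    then show ?case using time_dbl_minus_one[of x] by (simp add: power2_eq_square)
  next
    case (4 x)
    then show ?case using time_dbl_minus_one[of x] by (simp add: power2_eq_square)
  next
    case (6 x y)
    then show ?case
      using d[of x y] time_dbl(1)[of "val (sub_num_tm x y)"] by (simp add: power2_eq_square)
  next
    case (7 x y)
    then show ?case
      using d[of x y] time_dbl(1)[of "val (sub_num_tm x y)"] by (simp add: power2_eq_square)
  next
    case (8 x y)
    then show ?case
      using d[of x y] time_dbl(2)[of "val (sub_num_tm x y)"] by (simp add: power2_eq_square)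
  next
    case (9 x y)
    then show ?case
      using d[of x y] time_dbl(3)[of "val (sub_num_tm x y)"] by (simp add: power2_eq_square)
  qed (simp_all add: power2_eq_square)
qed

lemma val_neg_int [simp]: "int_of_bint (val (neg_int_tm a)) = - int_of_bint a"
  by (cases a) auto

lemma time_neg_int [simp]: "time (neg_int_tm a) = 1"
  by (cases a) auto

lemma val_add_int [simp]: "int_of_bint (val (add_int_tm a b)) = int_of_bint a + int_of_bint b"
  by (induction a b rule: add_int_tm.induct) auto

lemma time_add_int: "time (add_int_tm a b) \<le> Suc ((isize a + isize b + 2)\<^sup>2)"
proof (induction a b rule: add_int_tm.induct)
  case (6 x y)
  then show ?case using time_sub_num[of y x] by (simp add: add.commute)
qed (use time_add_num time_sub_num in auto)

lemma isize_add_int: "isize (val (add_int_tm a b)) \<le> Suc (max (isize a) (isize b))"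
proof (rule isize_le)
  have "\<bar>int_of_bint a\<bar> < 2 ^ Suc (max (isize a) (isize b))"
    by (rule less_le_trans[OF int_of_bint_bound]) (simp add: power_increasing)
  moreover have "\<bar>int_of_bint b\<bar> < 2 ^ Suc (max (isize a) (isize b))"
    by (rule less_le_trans[OF int_of_bint_bound]) (simp add: power_increasing)
  ultimately show "\<bar>int_of_bint (val (add_int_tm a b))\<bar> < 2 ^ Suc (Suc (max (isize a) (isize b)))"
    by simp
qed

lemma val_mult_int [simp]: "int_of_bint (val (mult_int_tm a b)) = int_of_bint a * int_of_bint b"
  by (induction a b rule: mult_int_tm.induct) auto

lemma isize_mult_int: "isize (val (mult_int_tm a b)) \<le> Suc (isize a + isize b)"
  using size_mult_num by (induction a b rule: mult_int_tm.induct) auto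

lemma time_mult_int:
  "time (mult_int_tm a b) \<le> Suc (Suc (isize b) * Suc ((2 * isize a + isize b + 4)\<^sup>2))"
  using time_mult_num by (induction a b rule: mult_int_tm.induct) auto

section \<open>Division and greatest common divisors\<close>

text \<open>A remainder below \<open>g\<close> with one more bit appended is below
  \<open>2 * g\<close>, so subtracting \<open>g\<close> at most once restores the range.\<close>

lemma val_div_step:
  assumes "0 \<le> int_of_bint r" "int_of_bint r < 2 * int (nat_of_num g)"
  shows "case val (div_step_tm g q r) of (q', r') \<Rightarrow>
    int_of_bint q' * int (nat_of_num g) + int_of_bint r' = 2 * int_of_bint q * int (nat_of_num g) + int_of_bint r \<and>
    0 \<le> int_of_bint r' \<and> int_of_bint r' < int (nat_of_num g)"
proof -
  define d where "d = val (add_int_tm r (BNeg g))"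
  have d: "int_of_bint d = int_of_bint r - int (nat_of_num g)" by (simp add: d_def)
  show ?thesis
    using assms d
    by (cases d) (auto simp: div_step_tm_def d_def[symmetric] algebra_simps)
qed

text \<open>The least significant bit is outermost, so the recursion reaches the leading bits of the
  dividend before the others, as in long division by hand. The statement is the loop invariant for
  the prefix treated so far.\<close>

lemma val_divmod_num:
  "case val (divmod_num_tm x g) of (q, r) \<Rightarrow>
     int_of_bint q * int (nat_of_num g) + int_of_bint r = int (nat_of_num x) \<and>
     0 \<le> int_of_bint r \<and> int_of_bint r < int (nat_of_num g)"
proof (induction x)
  case One
  have "(1::int) < 2 * int (nat_of_num g)"
    using nat_of_num_pos[of g] by linarith
  then show ?case
    using val_div_step[of "BPos num.One" g BZero] by simp
next
  case (Bit0 x)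
  obtain q r where qr: "val (divmod_num_tm x g) = (q, r)" by fastforce
  show ?case
    using Bit0 val_div_step[of "val (dbl_tm r)" g q]
    by (auto simp: qr algebra_simps split: prod.splits)
next
  case (Bit1 x)
  obtain q r where qr: "val (divmod_num_tm x g) = (q, r)" by fastforce
  show ?case
    using Bit1 val_div_step[of "val (dbl_inc_tm r)" g q]
    by (auto simp: qr algebra_simps split: prod.splits)
qed

text \<open>Divisibility gives g \<le> x. The quotient is therefore positive, and the default value
  \<open>num.One\<close> of \<open>div_num_tm\<close> is not taken.\<close>

lemma val_div_num:
  assumes "int (nat_of_num g) dvd int (nat_of_num x)"
  shows "int (nat_of_num (val (div_num_tm x g))) = int (nat_of_num x) div int (nat_of_num g)"
proof -
  obtain q r where qr: "val (divmod_num_tm x g) = (q, r)" by fastforce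
  have *: "int_of_bint q * int (nat_of_num g) + int_of_bint r = int (nat_of_num x)"
      "0 \<le> int_of_bint r" "int_of_bint r < int (nat_of_num g)"
    using val_divmod_num[where x = x and g = g] by (auto simp: qr)
  have q: "int_of_bint q = int (nat_of_num x) div int (nat_of_num g)"
    using * by (metis add.commute div_mult_self3 div_pos_pos_trivial add_0_right
        nat_of_num_pos of_nat_0_less_iff less_irrefl mult.commute)
  have "int (nat_of_num g) \<le> int (nat_of_num x)" using assms nat_of_num_pos by (intro zdvd_imp_le) auto
  then have "(0::int) < int (nat_of_num x) div int (nat_of_num g)"
    by (simp add: pos_imp_zdiv_pos_iff)
  with q obtain y where "q = BPos y" by (cases q) auto
  then show ?thesis using q by (simp add: div_num_tm_def qr)
qed

lemma time_div_step:
  assumes "isize r \<le> Suc (size g)"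
  shows "time (div_step_tm g q r) \<le> isize q + 4 + (2 * size g + 3)\<^sup>2"
proof -
  have "time (add_int_tm r (BNeg g)) \<le> Suc ((isize r + size g + 2)\<^sup>2)"
    using time_add_int[of r "BNeg g"] by simp
  also have "\<dots> \<le> Suc ((2 * size g + 3)\<^sup>2)"
    using assms by (simp add: power_mono)
  finally show ?thesis
    using time_dbl[of q] by (auto simp: div_step_tm_def split: bint.splits)
qed

lemma time_divmod_num:
  "time (divmod_num_tm x g) \<le> Suc (size x) * (size x + size g + 7 + (2 * size g + 3)\<^sup>2)"
proof -
  define C where "C = (2 * size g + 3)\<^sup>2"
  \<comment> \<open>The lengths follow from the invariant: r < g, and 0 \<le> q \<le> q * g \<le> x
    since g \<ge> 1.\<close>
  have qr: "isize q \<le> size x \<and> isize r \<le> size g \<and> isize (val (dbl_tm r)) \<le> Suc (size g) \<and>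
       isize (val (dbl_inc_tm r)) \<le> Suc (size g)"
    if "val (divmod_num_tm x g) = (q, r)" for x q r
  proof -
    have *: "int_of_bint q * int (nat_of_num g) + int_of_bint r = int (nat_of_num x)"
        "0 \<le> int_of_bint r" "int_of_bint r < int (nat_of_num g)"
      using val_divmod_num[where x = x and g = g] by (auto simp: that)
    have x: "int (nat_of_num x) < 2 ^ Suc (size x)" and g: "int (nat_of_num g) < 2 ^ Suc (size g)"
      using int_of_bint_bound[of "BPos x"] int_of_bint_bound[of "BPos g"] by auto
    have r: "\<bar>int_of_bint r\<bar> < 2 ^ Suc (size g)"
      using * g by simp
    have q0: "0 \<le> int_of_bint q"
    proof (rule ccontr)
      assume "\<not> 0 \<le> int_of_bint q"
      then have "int_of_bint q * int (nat_of_num g) \<le> (-1) * int (nat_of_num g)"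
        by (intro mult_right_mono) auto
      moreover have "(0::int) < int (nat_of_num x)" by simp
      ultimately show False using * by linarith
    qed
    have "int_of_bint q * 1 \<le> int_of_bint q * int (nat_of_num g)"
      by (rule mult_left_mono) (use q0 nat_of_num_pos[of g] in linarith)+
    then have "\<bar>int_of_bint q\<bar> < 2 ^ Suc (size x)"
      using * x q0 by linarith
    moreover have "\<bar>int_of_bint (val (dbl_tm r))\<bar> < 2 ^ Suc (Suc (size g))"
        "\<bar>int_of_bint (val (dbl_inc_tm r))\<bar> < 2 ^ Suc (Suc (size g))"
      using r *(2) by auto
    ultimately show ?thesis
      using r isize_le by blast
  qed
  show ?thesis
    unfolding C_def[symmetric]
  proof (induction x)
    case One
    then show ?case
      using time_div_step[of "BPos num.One" g BZero] by (simp add: C_def)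
  next
    case (Bit0 x)
    obtain q r where v: "val (divmod_num_tm x g) = (q, r)" by fastforce
    show ?case
      using Bit0 qr[OF v] time_div_step[of "val (dbl_tm r)" g q, folded C_def] time_dbl(1)[of r]
      by (simp add: v algebra_simps)
  next
    case (Bit1 x)
    obtain q r where v: "val (divmod_num_tm x g) = (q, r)" by fastforce
    show ?case
      using Bit1 qr[OF v] time_div_step[of "val (dbl_inc_tm r)" g q, folded C_def] time_dbl(2)[of r]
      by (simp add: v algebra_simps)
  qed
qed

lemma time_div_num:
  "time (div_num_tm x g) \<le> Suc (Suc (size x) * (size x + size g + 7 + (2 * size g + 3)\<^sup>2))"
  using time_divmod_num[of x g] by (simp add: div_num_tm_def split: prod.splits)

lemma gcd_double_odd:
  fixes a b :: int
  assumes "odd b"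
  shows "gcd (2 * a) b = gcd a b"
  using assms by (intro gcd_mult_left_left_cancel) simp

lemma val_gcd_num:
  "int (nat_of_num (val (gcd_num_tm x y))) = gcd (int (nat_of_num x)) (int (nat_of_num y))"
proof (induction x y rule: gcd_num_tm.induct)
  case (4 x y)
  then show ?case
    using gcd_mult_distrib_int[of 2 "int (nat_of_num x)" "int (nat_of_num y)"]
    by (simp only: gcd_num_tm.simps val_simps nat_of_num.simps mult_2[symmetric] of_nat_mult) simp
next
  case (5 x y)
  then show ?case
    using gcd_double_odd[of "int (nat_of_num (num.Bit1 y))" "int (nat_of_num x)"] by simp
next
  case (6 x y)
  then show ?case
    using gcd_double_odd[of "int (nat_of_num (num.Bit1 x))" "int (nat_of_num y)"]
    by (simp add: gcd.commute)
next
  case (7 x y)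
  define X where "X = int (nat_of_num (num.Bit1 x))"
  define Y where "Y = int (nat_of_num (num.Bit1 y))"
  define d where "d = val (sub_num_tm x y)"
  have XY: "X - Y = 2 * int_of_bint d" and odd: "odd X" "odd Y"
    by (simp_all add: d_def X_def Y_def)
  have "int (nat_of_num (val (gcd_num_tm (num.Bit1 x) (num.Bit1 y)))) = gcd X Y"
  proof (cases d)
    case BZero
    then have "X = Y" using XY by simp
    then show ?thesis using BZero X_def Y_def by (simp add: d_def[symmetric])
  next
    case (BPos z)
    have "gcd X Y = gcd (X - Y) Y"
      by (simp add: gcd_diff1)
    also have "\<dots> = gcd (int (nat_of_num z)) Y"
      using XY BPos odd gcd_double_odd by simp
    finally show ?thesis
      using 7(1)[OF refl d_def BPos] BPos by (simp add: d_def[symmetric] Y_def)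
  next
    case (BNeg z)
    have "gcd X Y = gcd (Y - X) X"
      by (metis gcd.commute gcd_diff1)
    also have "\<dots> = gcd (2 * int (nat_of_num z)) X"
      using XY BNeg by (intro arg_cong2[where f = gcd]) auto
    also have "\<dots> = gcd X (int (nat_of_num z))"
      using odd gcd_double_odd by (simp add: gcd.commute)
    finally show ?thesis
      using 7(2)[OF refl d_def BNeg] BNeg by (simp add: d_def[symmetric] X_def)
  qed
  then show ?case by (simp only: X_def Y_def)
qed auto

text \<open>Every recursive call decreases the total size of the arguments, and a call costs at most
  one subtraction. The separate bound \<open>n\<close> keeps the cost of a call constant throughout
  the induction.\<close>

lemma time_gcd_num:
  "size x + size y \<le> n \<Longrightarrow> time (gcd_num_tm x y) \<le> Suc (size x + size y) * Suc ((n + 2)\<^sup>2)"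
proof (induction x y rule: gcd_num_tm.induct)
  case (7 x y)
  define C where "C = Suc ((n + 2)\<^sup>2)"
  define d where "d = val (sub_num_tm x y)"
  have "time (sub_num_tm x y) \<le> (size x + size y + 2)\<^sup>2" by (rule time_sub_num)
  also have "\<dots> \<le> (n + 2)\<^sup>2" by (rule power_mono) (use 7(3) in simp_all)
  finally have s: "time (sub_num_tm x y) + 1 \<le> C" by (simp add: C_def)
  have "time (gcd_num_tm (num.Bit1 x) (num.Bit1 y)) \<le>
      Suc (size (num.Bit1 x) + size (num.Bit1 y)) * C"
  proof (cases d)
    case BZero
    then show ?thesis
      using s by (simp add: d_def[symmetric])
  next
    case (BPos z)
    then have z: "size z \<le> size x" using size_sub_num[of x y] by (simp add: d_def)
    then obtain e where e: "size x = size z + e" using le_Suc_ex by blast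
    from z have "size z + size (num.Bit1 y) \<le> n" using 7(3) by simp
    from 7(1)[OF refl d_def BPos this, folded C_def] z show ?thesis
      using s BPos e
      by (simp add: d_def[symmetric] algebra_simps)
  next
    case (BNeg z)
    then have z: "size z \<le> size y" using size_sub_num[of x y] by (simp add: d_def)
    then obtain e where e: "size y = size z + e" using le_Suc_ex by blast
    from z have "size (num.Bit1 x) + size z \<le> n" using 7(3) by simp
    from 7(2)[OF refl d_def BNeg this, folded C_def] z show ?thesis
      using s BNeg e
      by (simp add: d_def[symmetric] algebra_simps)
  qed
  then show ?case by (simp only: C_def)
qed simp_all

section \<open>Exact rational arithmetic\<close>

text \<open>Coprimality makes the representation unique; for zero it forces the denominator 1. Both
  the syntactic equality test and the length bounds rest on it.\<close>

definition rep :: "brat \<Rightarrow> rat \<Rightarrow> bool" where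
  "rep q v \<longleftrightarrow> coprime (int_of_bint (fst q)) (int (nat_of_num (snd q))) \<and> rat_of_brat q = v"

text \<open>This is a property of the number, not of its representation: some fraction with short
  terms must exist, reduced or not. It can thus be proved with any convenient common
  denominator.\<close>

definition small :: "nat \<Rightarrow> rat \<Rightarrow> bool" where
  "small b v \<longleftrightarrow> (\<exists>x y :: int. \<bar>x\<bar> \<le> 2 ^ b \<and> 0 < y \<and> y \<le> 2 ^ b \<and> v = of_int x / of_int y)"

definition runs :: "brat tm \<Rightarrow> rat \<Rightarrow> nat \<Rightarrow> nat \<Rightarrow> bool" where
  "runs c v b T \<longleftrightarrow> rep (val c) v \<and> small b v \<and> time c \<le> T"

lemma rat_of_brat_eq: "rat_of_brat (a, d) = of_int (int_of_bint a) / of_int (int (nat_of_num d))"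
  by (simp add: rat_of_brat_def nat_of_num_numeral)

lemma rep_quotient_of:
  assumes "rep q v"
  shows "quotient_of v = (int_of_bint (fst q), int (nat_of_num (snd q)))"
proof -
  obtain a d where q: "q = (a, d)" by fastforce
  have "v = Rat.Fract (int_of_bint a) (int (nat_of_num d))"
    using assms by (simp add: q rep_def rat_of_brat_eq Fract_of_int_quotient)
  then show ?thesis
    using assms by (simp add: q quotient_of_Fract normalize_stable rep_def)
qed

lemma inj_nat_of_num: "nat_of_num x = nat_of_num y \<longleftrightarrow> x = y"
  by (simp add: num_eq_iff)

lemma inj_int_of_bint: "int_of_bint a = int_of_bint b \<longleftrightarrow> a = b"
proof -
  have "int (nat_of_num x) \<noteq> - int (nat_of_num y)" "- int (nat_of_num x) \<noteq> int (nat_of_num y)"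
      "nat_of_num x \<noteq> 0" for x y
    using nat_of_num_pos[of x] by linarith+
  then show ?thesis
    by (cases a; cases b) (auto simp: num_eq_iff)
qed

lemma rep_unique: "rep p v \<Longrightarrow> rep q v \<Longrightarrow> p = q"
  using rep_quotient_of[of p v] rep_quotient_of[of q v]
  by (auto simp: inj_int_of_bint inj_nat_of_num intro: prod_eqI)

text \<open>If a/d is in lowest terms and equals x/y, then a divides x and d divides y. Any short
  fraction for the number therefore bounds the length of the reduced one.\<close>

lemma rep_size:
  assumes "rep q v" "small b v"
  shows "isize (fst q) \<le> b" "size (snd q) \<le> b"
proof -
  define a d where "a = int_of_bint (fst q)" and "d = int (nat_of_num (snd q))"
  have v: "v = of_int a / of_int d" and co: "coprime a d" and d: "d > 0"
    using assms(1) by (auto simp: rep_def a_def d_def rat_of_brat_def nat_of_num_numeral)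
  obtain x y where xy: "\<bar>x\<bar> \<le> 2 ^ b" "0 < y" "y \<le> 2 ^ b" "v = of_int x / of_int y"
    using assms(2) by (auto simp: small_def)
  have "rat_of_int (x * d) = of_int (a * y)"
    using v xy d by (simp add: field_simps)
  then have eq: "x * d = a * y" by (simp only: of_int_eq_iff)
  have "d dvd y" using co eq by (metis coprime_commute coprime_dvd_mult_right_iff dvd_triv_right)
  then have "d \<le> y" using xy by (simp add: zdvd_imp_le)
  have "a dvd x" using co eq by (metis coprime_dvd_mult_left_iff dvd_triv_left)
  \<comment> \<open>Divisibility bounds \<open>a\<close> only for nonzero \<open>x\<close>; if
    \<open>x\<close> is 0, then so is \<open>a\<close>.\<close>
  have "\<bar>a\<bar> \<le> \<bar>x\<bar>"
  proof (cases "x = 0")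
    case True
    then have "a = 0" using eq xy by simp
    then show ?thesis by simp
  next
    case False
    then show ?thesis using \<open>a dvd x\<close> by (rule dvd_imp_le_int)
  qed
  then have "\<bar>int_of_bint (fst q)\<bar> \<le> 2 ^ b" using xy a_def by simp
  moreover have "(2::int) ^ b < 2 ^ Suc b" by simp
  ultimately show "isize (fst q) \<le> b" by (intro isize_le) linarith
  have "d < 2 ^ Suc b" using \<open>d \<le> y\<close> xy \<open>(2::int) ^ b < 2 ^ Suc b\<close> by linarith
  then show "size (snd q) \<le> b" using isize_le[of "BPos (snd q)"] by (simp add: d_def)
qed

lemma small_mono:
  assumes "small b v" "b \<le> c"
  shows "small c v"
proof -
  have "(2::int) ^ b \<le> 2 ^ c" using assms(2) by (rule power_increasing) simp
  moreover obtain x y :: int where "\<bar>x\<bar> \<le> 2 ^ b" "0 < y" "y \<le> 2 ^ b" "v = of_int x / of_int y"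
    using assms(1) by (auto simp: small_def)
  ultimately have "\<bar>x\<bar> \<le> 2 ^ c \<and> 0 < y \<and> y \<le> 2 ^ c \<and> v = of_int x / of_int y" 
    by (auto intro: order_trans)
  then show ?thesis unfolding small_def by blast
qed

lemma small_of_rep:
  assumes "rep q v" "isize (fst q) < b" "size (snd q) < b"
  shows "small b v"
proof -
  have "\<bar>int_of_bint (fst q)\<bar> < 2 ^ Suc (isize (fst q))" by (rule int_of_bint_bound)
  also have "\<dots> \<le> 2 ^ b" using assms by (intro power_increasing) auto
  finally have a: "\<bar>int_of_bint (fst q)\<bar> \<le> 2 ^ b" by simp
  have "int (nat_of_num (snd q)) < 2 ^ Suc (size (snd q))" by (rule int_num_less)
  also have "\<dots> \<le> 2 ^ b" using assms by (intro power_increasing) auto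
  finally have "int (nat_of_num (snd q)) \<le> 2 ^ b" by simp
  moreover have "0 < int (nat_of_num (snd q))" by simp
  moreover have "v = of_int (int_of_bint (fst q)) / of_int (int (nat_of_num (snd q)))"
    using assms(1) by (simp add: rep_def rat_of_brat_def nat_of_num_numeral)
  ultimately show ?thesis using a unfolding small_def by blast
qed

lemma small_0 [simp]: "small b 0"
  unfolding small_def by (intro exI[of _ 0] exI[of _ 1]) simp

lemma small_1 [simp]: "small b 1"
  unfolding small_def by (intro exI[of _ 1]) simp

lemma small_uminus:
  assumes "small b v"
  shows "small b (- v)"
proof -
  obtain x y :: int where "\<bar>x\<bar> \<le> 2 ^ b" "0 < y" "y \<le> 2 ^ b" "v = of_int x / of_int y"
    using assms by (auto simp: small_def)
  then have "\<bar>- x\<bar> \<le> 2 ^ b \<and> 0 < y \<and> y \<le> 2 ^ b \<and> - v = of_int (- x) / of_int y" by simp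
  then show ?thesis unfolding small_def by blast
qed

lemma small_mult:
  assumes "small b v" "small c w"
  shows "small (b + c) (v * w)"
proof -
  obtain x y x' y' :: int where *: "\<bar>x\<bar> \<le> 2 ^ b" "0 < y" "y \<le> 2 ^ b" "v = of_int x / of_int y"
      "\<bar>x'\<bar> \<le> 2 ^ c" "0 < y'" "y' \<le> 2 ^ c" "w = of_int x' / of_int y'"
    using assms by (auto simp: small_def)
  have "\<bar>x * x'\<bar> \<le> 2 ^ (b + c)" "y * y' \<le> 2 ^ (b + c)"
    using * by (auto simp: abs_mult power_add intro!: mult_mono)
  moreover have "0 < y * y'" "v * w = of_int (x * x') / of_int (y * y')" using * by auto
  ultimately show ?thesis unfolding small_def by blast
qed

lemma small_add:
  assumes "small b v" "small c w"
  shows "small (Suc (b + c)) (v + w)"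
proof -
  obtain x y x' y' :: int where *: "\<bar>x\<bar> \<le> 2 ^ b" "0 < y" "y \<le> 2 ^ b" "v = of_int x / of_int y"
      "\<bar>x'\<bar> \<le> 2 ^ c" "0 < y'" "y' \<le> 2 ^ c" "w = of_int x' / of_int y'"
    using assms by (auto simp: small_def)
  have "\<bar>x * y'\<bar> \<le> 2 ^ b * 2 ^ c" "\<bar>x' * y\<bar> \<le> 2 ^ c * 2 ^ b" "y * y' \<le> 2 ^ b * 2 ^ c"
    unfolding abs_mult using * by (auto intro!: mult_mono)
  moreover have "\<bar>x * y' + x' * y\<bar> \<le> \<bar>x * y'\<bar> + \<bar>x' * y\<bar>" by (rule abs_triangle_ineq)
  ultimately have "\<bar>x * y' + x' * y\<bar> \<le> 2 ^ Suc (b + c)" "y * y' \<le> 2 ^ Suc (b + c)"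
    using * by (auto simp: power_add mult.commute)
  moreover have "0 < y * y'" "v + w = of_int (x * y' + x' * y) / of_int (y * y')"
    using * by (auto simp: field_simps)
  ultimately show ?thesis unfolding small_def by blast
qed

section \<open>Cost and correctness of operations on reduced fractions\<close>

lemma rep_reduce: "rep (val (reduce_tm a d)) (of_int (int_of_bint a) / of_nat (nat_of_num d))"
proof -
  have *: "rep (val (reduce_tm a d)) (of_int (int_of_bint a) / of_nat (nat_of_num d))"
    if ax: "a = BPos x \<or> a = BNeg x" for x
  proof -
    define g where "g = val (gcd_num_tm x d)"
    define x' where "x' = val (div_num_tm x g)"
    define d' where "d' = val (div_num_tm d g)"
    have g: "int (nat_of_num g) = gcd (int (nat_of_num x)) (int (nat_of_num d))"
      by (simp add: g_def val_gcd_num)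
    have x': "int (nat_of_num x') = int (nat_of_num x) div int (nat_of_num g)"
      unfolding x'_def by (rule val_div_num) (simp add: g)
    have d': "int (nat_of_num d') = int (nat_of_num d) div int (nat_of_num g)"
      unfolding d'_def by (rule val_div_num) (simp add: g)
    have co: "coprime (int (nat_of_num x')) (int (nat_of_num d'))"
      unfolding x' d' g by (rule div_gcd_coprime) simp
    have "int (nat_of_num x) = int (nat_of_num x') * int (nat_of_num g)"
         "int (nat_of_num d) = int (nat_of_num d') * int (nat_of_num g)"
      by (simp_all add: x' d' g)
    then have xd: "nat_of_num x = nat_of_num x' * nat_of_num g"
        "nat_of_num d = nat_of_num d' * nat_of_num g"
      by (simp_all only: of_nat_eq_iff flip: of_nat_mult)
    from ax show ?thesis
    proof
      assume a: "a = BPos x"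
      show ?thesis
        using co by (simp add: a rep_def rat_of_brat_eq g_def[symmetric] x'_def[symmetric]
            d'_def[symmetric] xd)
    next
      assume a: "a = BNeg x"
      show ?thesis
        using co by (simp add: a rep_def rat_of_brat_eq g_def[symmetric] x'_def[symmetric]
            d'_def[symmetric] xd)
    qed
  qed
  then show ?thesis
    by (cases a) (auto simp: rep_def rat_of_brat_eq)
qed

definition t_reduce :: "nat \<Rightarrow> nat" where
  "t_reduce k = 1 + Suc (2 * k) * Suc ((2 * k + 2)\<^sup>2)
     + 2 * Suc (Suc k * (2 * k + 7 + (2 * k + 3)\<^sup>2))"

lemma time_reduce:
  assumes "isize a \<le> k" "size d \<le> k"
  shows "time (reduce_tm a d) \<le> t_reduce k"
proof -
  have *: "time (gcd_num_tm x d) + (time (div_num_tm x g) + time (div_num_tm d g)) + 1 \<le> t_reduce k"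
    if x: "size x \<le> k" and g: "g = val (gcd_num_tm x d)" for x g
  proof -
    \<comment> \<open>The gcd is at most the denominator, so the divisor in both divisions has
      length at most \<open>k\<close> as well.\<close>
    have "gcd (int (nat_of_num x)) (int (nat_of_num d)) \<le> int (nat_of_num d)"
      by (intro zdvd_imp_le) auto
    then have "int (nat_of_num g) \<le> int (nat_of_num d)"
      by (simp add: g val_gcd_num)
    also have "\<dots> < 2 ^ Suc (size d)" by (rule int_num_less)
    finally have "size g \<le> size d" using isize_le[of "BPos g"] by simp
    then have gk: "size g \<le> k" using assms by simp
    have "time (gcd_num_tm x d) \<le> Suc (size x + size d) * Suc ((2 * k + 2)\<^sup>2)"
      by (rule time_gcd_num) (use x assms in simp)
    also have "\<dots> \<le> Suc (2 * k) * Suc ((2 * k + 2)\<^sup>2)"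
      by (rule mult_right_mono) (use x assms in simp_all)
    finally have 1: "time (gcd_num_tm x d) \<le> \<dots>" .
    have 2: "time (div_num_tm y g) \<le> Suc (Suc k * (2 * k + 7 + (2 * k + 3)\<^sup>2))"
      if "size y \<le> k" for y
    proof -
      have "time (div_num_tm y g) \<le> Suc (Suc (size y) * (size y + size g + 7 + (2 * size g + 3)\<^sup>2))"
        by (rule time_div_num)
      also have "\<dots> \<le> Suc (Suc k * (2 * k + 7 + (2 * k + 3)\<^sup>2))"
        unfolding Suc_le_mono
        by (intro mult_mono add_mono power_mono) (use that gk in auto)
      finally show ?thesis .
    qed
    show ?thesis using 1 2[OF x] 2[OF assms(2)] by (simp add: t_reduce_def)
  qed
  show ?thesis
  proof (cases a)
    case BZero
    then show ?thesis by (simp add: t_reduce_def)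
  next
    case (BPos x)
    then show ?thesis using *[of x] assms by simp
  next
    case (BNeg x)
    then show ?thesis using *[of x] assms by simp
  qed
qed

text \<open>One bound for addition, subtraction and multiplication of fractions with terms of size
  at most \<open>n\<close>: three integer products, one sum of two integers of size at most
  \<open>2 * n + 1\<close>, and one reduction of terms of size at most
  \<open>2 * n + 2\<close>.\<close>

definition t_rat :: "nat \<Rightarrow> nat" where
  "t_rat n = 3 + 3 * Suc (Suc n * Suc ((3 * n + 4)\<^sup>2)) + Suc ((4 * n + 4)\<^sup>2) + t_reduce (2 * n + 2)"

lemma time_mult_int_le:
  assumes "isize a \<le> n" "isize b \<le> n"
  shows "time (mult_int_tm a b) \<le> Suc (Suc n * Suc ((3 * n + 4)\<^sup>2))"
proof -
  have "time (mult_int_tm a b) \<le> Suc (Suc (isize b) * Suc ((2 * isize a + isize b + 4)\<^sup>2))"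
    by (rule time_mult_int)
  also have "\<dots> \<le> Suc (Suc n * Suc ((3 * n + 4)\<^sup>2))"
    unfolding Suc_le_mono Suc_eq_plus1 by (intro mult_mono add_mono power_mono) (use assms in auto)
  finally show ?thesis .
qed

lemma time_mult_num_le:
  assumes "size a \<le> n" "size b \<le> n"
  shows "time (mult_num_tm a b) \<le> Suc n * Suc ((3 * n + 4)\<^sup>2)"
  using time_mult_int_le[of "BPos a" n "BPos b"] assms by simp

lemma runs_mult:
  assumes "rep p v" "small b v" "rep q w" "small c w" "b \<le> n" "c \<le> n"
  shows "runs (mult_rat_tm p q) (v * w) (b + c) (t_rat n)"
proof -
  obtain x y x' y' where pq: "p = (x, y)" "q = (x', y')" by fastforce
  have sz: "isize x \<le> n" "size y \<le> n" "isize x' \<le> n" "size y' \<le> n"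
    using rep_size[OF assms(1,2)] rep_size[OF assms(3,4)] assms(5,6) by (auto simp: pq)
  have "rep (val (mult_rat_tm p q)) (v * w)"
    using rep_reduce[of "val (mult_int_tm x x')" "y * y'"] assms(1,3)
    by (auto simp: pq rep_def rat_of_brat_eq)
  moreover have "time (reduce_tm (val (mult_int_tm x x')) (y * y')) \<le> t_reduce (2 * n + 2)"
    by (rule time_reduce)
       (use isize_mult_int[of x x'] size_mult_num[of y y'] sz in linarith)+
  then have "time (mult_rat_tm p q) \<le> t_rat n"
    using time_mult_int_le[OF sz(1,3)] time_mult_num_le[OF sz(2,4)]
    by (simp add: pq t_rat_def)
  ultimately show ?thesis
    using small_mult[OF assms(2,4)] by (simp add: runs_def)
qed

text \<open>The slack of 2 pays for the tick and the negation by which \<open>sub_rat_tm\<close>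
  precedes the addition.\<close>

lemma time_rep_add:
  assumes "rep p v" "small n v" "rep q w" "small n w"
  shows "rep (val (add_rat_tm p q)) (v + w)" "time (add_rat_tm p q) + 2 \<le> t_rat n"
proof -
  obtain x y x' y' where pq: "p = (x, y)" "q = (x', y')" by fastforce
  have sz: "isize x \<le> n" "size y \<le> n" "isize x' \<le> n" "size y' \<le> n"
    using rep_size[OF assms(1,2)] rep_size[OF assms(3,4)] by (auto simp: pq)
  define f g where "f = val (mult_int_tm x (BPos y'))" and "g = val (mult_int_tm x' (BPos y))"
  have fg: "isize f \<le> 2 * n + 1" "isize g \<le> 2 * n + 1"
    using isize_mult_int[of x "BPos y'"] isize_mult_int[of x' "BPos y"] sz
    by (simp_all add: f_def g_def)
  have "v + w = of_int (int_of_bint (val (add_int_tm f g))) / of_nat (nat_of_num (y * y'))"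
    using assms(1,3) by (auto simp: f_def g_def pq rep_def rat_of_brat_eq field_simps)
  then show "rep (val (add_rat_tm p q)) (v + w)"
    using rep_reduce[of "val (add_int_tm f g)" "y * y'"]
    by (simp add: f_def g_def pq)
  have "time (reduce_tm (val (add_int_tm f g)) (y * y')) \<le> t_reduce (2 * n + 2)"
    by (rule time_reduce)
       (use isize_add_int[of f g] size_mult_num[of y y'] sz fg in linarith)+
  moreover have "time (add_int_tm f g) \<le> Suc ((isize f + isize g + 2)\<^sup>2)" by (rule time_add_int)
  then have "time (add_int_tm f g) \<le> Suc ((4 * n + 4)\<^sup>2)"
    by (rule order_trans) (use fg in \<open>simp add: power_mono\<close>)
  moreover have "time (mult_int_tm x (BPos y')) \<le> Suc (Suc n * Suc ((3 * n + 4)\<^sup>2))"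
    "time (mult_int_tm x' (BPos y)) \<le> Suc (Suc n * Suc ((3 * n + 4)\<^sup>2))"
    using sz by (auto intro!: time_mult_int_le simp del: mult_Suc mult_Suc_right)
  ultimately show "time (add_rat_tm p q) + 2 \<le> t_rat n"
    using time_mult_num_le[OF sz(2,4)]
    by (simp add: pq t_rat_def f_def[symmetric] g_def[symmetric])
qed

lemma runs_add:
  assumes "rep p v" "small b v" "rep q w" "small c w" "b \<le> n" "c \<le> n"
  shows "runs (add_rat_tm p q) (v + w) (Suc (b + c)) (t_rat n)"
proof -
  have "small n v" "small n w"
    using assms small_mono by blast+
  from time_rep_add[OF assms(1) this(1) assms(3) this(2)] show ?thesis
    using small_add[OF assms(2,4)] by (simp add: runs_def)
qed

lemma runs_sub:
  assumes "rep p v" "small b v" "rep q w" "small c w" "b \<le> n" "c \<le> n"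
  shows "runs (sub_rat_tm p q) (v - w) (Suc (b + c)) (t_rat n)"
proof -
  obtain x y where q: "q = (x, y)" by fastforce
  define q' where "q' = (val (neg_int_tm x), y)"
  have q': "rep q' (- w)"
    using assms(3) by (auto simp: rep_def q q'_def rat_of_brat_eq)
  have "small n v" "small n (- w)"
    using assms small_uminus small_mono by blast+
  from time_rep_add[OF assms(1) this(1) q' this(2)] show ?thesis
    using small_add[OF assms(2) small_uminus[OF assms(4)]] by (simp add: runs_def q q'_def)
qed

lemma rep_0: "rep (BZero, num.One) 0"
  and rep_1: "rep (BPos num.One, num.One) 1"
  by (simp_all add: rep_def rat_of_brat_eq)

lemma runs_mono: "runs c v b T \<Longrightarrow> b \<le> b' \<Longrightarrow> T \<le> T' \<Longrightarrow> runs c v b' T'"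
  by (auto simp: runs_def intro: small_mono)

text \<open>Every addition joins one summand of length \<open>b\<close> to the partial sum and
  lengthens it by \<open>Suc b\<close> only. The length of a sum is therefore linear in the number
  of terms, and \<open>L * Suc b\<close> bounds the operands of all its additions.\<close>

lemma runs_sum:
  assumes "\<And>x. x \<in> set xs \<Longrightarrow> runs (f x) (v x) b T" and "length xs \<le> L"
  shows "runs (sum_tm f xs) (sum_list (map v xs)) (L * Suc b) (L * (1 + T + t_rat (L * Suc b)) + 1)"
proof -
  define U where "U = 1 + T + t_rat (L * Suc b)"
  have "runs (sum_tm f xs) (sum_list (map v xs)) (length xs * Suc b) (length xs * U + 1)"
    using assms
  proof (induction xs)
    case Nil
    then show ?case by (simp add: runs_def rep_0)
  next
    case (Cons x xs)
    have x: "runs (f x) (v x) b T" using Cons by simp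
    have xs: "runs (sum_tm f xs) (sum_list (map v xs)) (length xs * Suc b) (length xs * U + 1)"
      using Cons by simp
    have "Suc (length xs) * Suc b \<le> L * Suc b" using Cons(3) by (intro mult_right_mono) auto
    then have "runs (add_rat_tm (val (f x)) (val (sum_tm f xs))) (v x + sum_list (map v xs))
      (Suc (b + length xs * Suc b)) (t_rat (L * Suc b))"
      using x xs by (intro runs_add) (auto simp: runs_def)
    then show ?case using x xs by (simp add: runs_def U_def add_ac)
  qed
  then show ?thesis
    unfolding U_def[symmetric]
    by (rule runs_mono) (use assms(2) in \<open>intro add_right_mono mult_right_mono; simp\<close>)+
qed

section \<open>Equality tests\<close>

lemma val_eq_num [simp]: "val (eq_num_tm x y) \<longleftrightarrow> x = y"
  by (induction x y rule: eq_num_tm.induct) auto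

lemma time_eq_num: "time (eq_num_tm x y) \<le> Suc (size x)"
  by (induction x y rule: eq_num_tm.induct) auto

lemma val_eq_rat [simp]: "val (eq_rat_tm p q) \<longleftrightarrow> p = q"
proof -
  have "val (eq_int_tm a b) \<longleftrightarrow> a = b" for a b
    by (induction a b rule: eq_int_tm.induct) auto
  then show ?thesis by (cases p; cases q) auto
qed

lemma time_eq_rat:
  assumes "isize (fst p) \<le> n" "size (snd p) \<le> n"
  shows "time (eq_rat_tm p q) \<le> 2 * n + 4"
proof -
  have i: "time (eq_int_tm a b) \<le> isize a + 2" for a b
    using time_eq_num by (induction a b rule: eq_int_tm.induct) auto
  show ?thesis
    using i[of "fst p" "fst q"] time_eq_num[of "snd p" "snd q"] assms
    by (cases p; cases q) auto
qed

section \<open>Unary numbers and lists\<close>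

lemma val_eq_nat [simp]: "val (eq_nat_tm x y) \<longleftrightarrow> x = y"
  by (induction x y rule: eq_nat_tm.induct) auto

lemma time_eq_nat: "time (eq_nat_tm x y) \<le> Suc x"
  by (induction x y rule: eq_nat_tm.induct) auto

lemma val_add_nat [simp]: "val (add_nat_tm x y) = x + y"
  by (induction x y rule: add_nat_tm.induct) auto

lemma time_add_nat [simp]: "time (add_nat_tm x y) = Suc x"
  by (induction x y rule: add_nat_tm.induct) auto

lemma val_mult_nat [simp]: "val (mult_nat_tm x y) = x * y"
  by (induction x y rule: mult_nat_tm.induct) auto

lemma time_mult_nat [simp]: "time (mult_nat_tm x y) = x * (y + 2) + 1"
  by (induction x y rule: mult_nat_tm.induct) auto

lemma val_minus_nat [simp]: "val (minus_nat_tm x y) = x - y"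
  by (induction x y rule: minus_nat_tm.induct) auto

lemma time_minus_nat: "time (minus_nat_tm x y) \<le> Suc y"
  by (induction x y rule: minus_nat_tm.induct) auto

lemma val_range [simp]: "val (range_tm a n) = [a..<a + n]"
  by (induction a n rule: range_tm.induct) (auto simp: upt_conv_Cons)

lemma time_range [simp]: "time (range_tm a n) = Suc n"
  by (induction a n rule: range_tm.induct) auto

declare range_tm.simps [simp del]

lemma val_length [simp]: "val (length_tm xs) = length xs"
  by (induction xs) auto

lemma time_length [simp]: "time (length_tm xs) = Suc (length xs)"
  by (induction xs) auto

lemma val_nth [simp]: "n < length xs \<Longrightarrow> val (nth_tm xs n) = xs ! n"
  by (induction xs n rule: nth_tm.induct) auto

lemma time_nth: "time (nth_tm xs n) \<le> Suc n"
  by (induction xs n rule: nth_tm.induct) auto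

lemma val_snoc [simp]: "val (snoc_tm xs y) = xs @ [y]"
  by (induction xs y rule: snoc_tm.induct) auto

lemma time_snoc [simp]: "time (snoc_tm xs y) = Suc (length xs)"
  by (induction xs y rule: snoc_tm.induct) auto

lemma val_map [simp]: "val (map_tm f xs) = map (\<lambda>x. val (f x)) xs"
  by (induction f xs rule: map_tm.induct) auto

lemma time_map: "(\<And>x. x \<in> set xs \<Longrightarrow> time (f x) \<le> T) \<Longrightarrow> time (map_tm f xs) \<le> length xs * Suc T + 1"
proof (induction xs)
  case (Cons x xs)
  from Cons(1)[OF Cons(2)] Cons(2)[of x] show ?case by simp
qed simp

lemma val_num_of_Suc [simp]: "nat_of_num (val (num_of_Suc_tm n)) = Suc n"
  by (induction n) (auto simp: nat_of_num_inc)

lemma size_num_of_Suc: "size (val (num_of_Suc_tm n)) \<le> n"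
proof (rule size_num_le)
  have "Suc n < 2 ^ Suc n" by (rule less_exp)
  then show "nat_of_num (val (num_of_Suc_tm n)) < 2 ^ Suc n" by simp
qed

lemma time_num_of_Suc: "time (num_of_Suc_tm n) \<le> (n + 1) * (n + 2)"
proof (induction n)
  case (Suc n)
  have "time (inc_tm (val (num_of_Suc_tm n))) \<le> Suc n"
    using time_inc size_num_of_Suc order_trans by (metis Suc_le_mono)
  with Suc show ?case by simp
qed simp

lemma val_matrix [simp]: "val (matrix_tm m f) = map (\<lambda>i. map (\<lambda>j. val (f i j)) [0..<m]) [0..<m]"
  by (simp add: matrix_tm_def)

lemma time_matrix:
  assumes "\<And>i j. i < m \<Longrightarrow> j < m \<Longrightarrow> time (f i j) \<le> T"
  shows "time (matrix_tm m f) \<le> m + m * (m * Suc T + 2) + 3"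
proof -
  have "time (map_tm (\<lambda>j. f i j) [0..<m]) \<le> m * Suc T + 1" if "i < m" for i
    using time_map[of "[0..<m]" "f i" T] assms that by simp
  then have "time (map_tm (\<lambda>i. map_tm (\<lambda>j. f i j) [0..<m]) [0..<m]) \<le> m * Suc (m * Suc T + 1) + 1"
    using time_map[of "[0..<m]" "\<lambda>i. map_tm (\<lambda>j. f i j) [0..<m]" "m * Suc T + 1"] by simp
  then show ?thesis by (simp add: matrix_tm_def)
qed

section \<open>The size of the coefficients\<close>

lemma Ints_mult_of_dvd:
  fixes u v :: rat
  assumes "of_nat x * u \<in> \<int>" "of_nat y * v \<in> \<int>" "x * y dvd z"
  shows "of_nat z * (u * v) \<in> \<int>"
proof -
  obtain w where z: "z = x * y * w" using assms(3) by blast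
  have "of_nat z * (u * v) = of_nat w * ((of_nat x * u) * (of_nat y * v))"
    by (simp add: z)
  also have "\<dots> \<in> \<int>" by (intro Ints_mult assms Ints_of_nat)
  finally show ?thesis .
qed

lemma Ints_of_dvd:
  fixes u :: rat
  assumes "of_nat x * u \<in> \<int>" "x dvd z"
  shows "of_nat z * u \<in> \<int>"
  using Ints_mult_of_dvd[of x u 1 1 z] assms by simp

text \<open>Binomial coefficients are integers. This is the step that lets a convolution of
  coefficients keep a factorial times a power of 2 as denominator.\<close>

lemma denominator_dvd:
  assumes "a + b \<le> c"
  shows "(2 ^ a * fact x) * (2 ^ b * fact y) dvd (2 ^ c * fact (x + y) :: nat)"
proof -
  have "(2 ^ a * 2 ^ b :: nat) dvd 2 ^ c"
    using assms by (simp add: le_imp_power_dvd flip: power_add)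
  then have "(2 ^ a * 2 ^ b) * (fact x * fact y) dvd (2 ^ c * fact (x + y) :: nat)"
    by (rule mult_dvd_mono) (rule fact_fact_dvd_fact)
  then show ?thesis by (simp add: ac_simps)
qed

text \<open>This and the next lemma keep the recurrences available for a single explicit unfolding,
  after which the defining equations leave the simp set.\<close>

lemma coeff_A_Suc_eq:
  "coeff_A H (Suc t) i j = 1 / (2 * (of_nat t + 1) * (2 * of_nat t + 1)) *
    ((\<Sum>k<length H. \<Sum>p\<in>{0..t}. (coeff_A H p i j - coeff_A H p k j) * coeff_R H (t - p) i k)
      - (\<Sum>k<length H. of_bool (H ! i ! k) * (coeff_A H t i j - coeff_A H t k j)))"
  by simp

lemma coeff_R_eq:
  assumes "i \<noteq> k" "s \<noteq> 0"
  shows "coeff_R H s i k = - (1 / 2) * (\<Sum>c\<in>{1..s}. coeff_R H (s - c) i k *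
    (\<Sum>l<length H. \<Sum>d\<in>{0..c}. (coeff_A H d i l - coeff_A H d k l) *
      (coeff_A H (c - d) i l - coeff_A H (c - d) k l)))"
  using assms by simp

declare coeff_A.simps(2) [simp del] coeff_R.simps [simp del]

text \<open>The numbers $(2s)!\,a_{ij}^s$ and $(2s)!\,r_{ik}^s$ are the derivatives at 0, and the
  recurrence between those has binomial coefficients and factors $\frac12$ only. The exponents of 2
  leave room for the truncated value of \<open>2 * s - 1\<close> at \<open>s = 0\<close>.\<close>

lemma coeff_denominators:
  "of_nat (2 ^ (2 * s - 1) * fact (2 * s)) * coeff_A H s i j \<in> \<int> \<and>
   of_nat (2 ^ (2 * s + 1) * fact (2 * s)) * coeff_R H s i k \<in> \<int>"
proof (induction s arbitrary: i j k rule: less_induct)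
  case (less s)
  define D where "D s = (2 ^ (2 * s - 1) * fact (2 * s) :: nat)" for s
  define E where "E s = (2 ^ (2 * s + 1) * fact (2 * s) :: nat)" for s
  have A: "of_nat (D t) * coeff_A H t i j \<in> \<int>" if "t < s" for t i j
    using less[OF that] by (simp only: D_def)
  have R: "of_nat (E t) * coeff_R H t i k \<in> \<int>" if "t < s" for t i k
    using less[OF that] by (simp only: E_def)
  have As: "of_nat (D s) * coeff_A H s i j \<in> \<int>" for i j
  proof (cases s)
    case 0
    then show ?thesis by (simp add: D_def)
  next
    case (Suc t)
    have 1: "of_nat (E t) * ((coeff_A H p i j - coeff_A H p k j) * coeff_R H (t - p) i k) \<in> \<int>"
      if "p \<le> t" for p k
    proof (rule Ints_mult_of_dvd)
      show "of_nat (D p) * (coeff_A H p i j - coeff_A H p k j) \<in> \<int>"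
        unfolding right_diff_distrib using A that Suc by (intro Ints_diff) auto
      show "of_nat (E (t - p)) * coeff_R H (t - p) i k \<in> \<int>"
        using R Suc by simp
      \<comment> \<open>For p = 0 the truncated \<open>2 * p - 1\<close> is 0, and the two exponents
        of 2 add up to exactly \<open>2 * t + 1\<close>.\<close>
      have "2 * p + 2 * (t - p) = 2 * t" using that by simp
      then show "D p * E (t - p) dvd E t"
        unfolding D_def E_def
        using denominator_dvd[of "2 * p - 1" "2 * (t - p) + 1" "2 * t + 1" "2 * p" "2 * (t - p)"]
        by simp
    qed
    have 2: "of_nat (E t) * (of_bool (H ! i ! k) * (coeff_A H t i j - coeff_A H t k j)) \<in> \<int>" for k
    proof -
      have "D t dvd E t" unfolding D_def E_def by (intro mult_dvd_mono le_imp_power_dvd) auto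
      moreover have "of_nat (D t) * (coeff_A H t i j - coeff_A H t k j) \<in> \<int>"
        unfolding right_diff_distrib using A Suc by (intro Ints_diff) auto
      ultimately have "of_nat (E t) * (coeff_A H t i j - coeff_A H t k j) \<in> \<int>"
        by (metis Ints_of_dvd)
      then show ?thesis by (cases "H ! i ! k") simp_all
    qed
    \<comment> \<open>The prefactor is absorbed exactly, since (2t+2)! = (2t)! * 2(t+1)(2t+1) and
      both powers of 2 have exponent 2t+1.\<close>
    have DE: "of_nat (D s) * (1 / (2 * (of_nat t + 1) * (2 * of_nat t + 1))) = (of_nat (E t) :: rat)"
    proof -
      have "D s = E t * (2 * (t + 1) * (2 * t + 1))"
        unfolding Suc D_def E_def by (simp add: algebra_simps)
      then have "(of_nat (D s) :: rat) = of_nat (E t) * (2 * (of_nat t + 1) * (2 * of_nat t + 1))"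
        by (simp only: of_nat_mult of_nat_add of_nat_1 of_nat_numeral)
      moreover have "2 * (of_nat t + 1) * (2 * of_nat t + 1) \<noteq> (0 :: rat)"
        by (metis of_nat_Suc of_nat_mult of_nat_numeral mult_eq_0_iff of_nat_0_neq add.commute
            zero_neq_numeral)
      ultimately show ?thesis by simp
    qed
    define X Y where "X = (\<Sum>k<length H. \<Sum>p\<in>{0..t}.
        (coeff_A H p i j - coeff_A H p k j) * coeff_R H (t - p) i k)"
      and "Y = (\<Sum>k<length H. of_bool (H ! i ! k) * (coeff_A H t i j - coeff_A H t k j))"
    have "of_nat (E t) * X \<in> \<int>"
      unfolding X_def sum_distrib_left by (intro Ints_sum 1) simp
    moreover have "of_nat (E t) * Y \<in> \<int>"
      unfolding Y_def sum_distrib_left by (intro Ints_sum 2)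
    moreover have "of_nat (D s) * coeff_A H s i j = of_nat (E t) * X - of_nat (E t) * Y"
      unfolding Suc coeff_A_Suc_eq mult.assoc[symmetric] DE[unfolded Suc] X_def Y_def
      by (rule right_diff_distrib)
    ultimately show ?thesis by simp
  qed
  \<comment> \<open>The recurrence for r at index \<open>s\<close> involves a at index
    \<open>s\<close> itself, namely for c = s with d = 0 or d = s. The claim just proved therefore
    has to join the induction hypothesis.\<close>
  have Ds: "of_nat (D t) * coeff_A H t i j \<in> \<int>" if "t \<le> s" for t i j
    using A As that by (cases "t = s") auto
  have "of_nat (E s) * coeff_R H s i k \<in> \<int>" for i k
  proof (cases "i = k \<or> s = 0")
    case True
    then show ?thesis by (auto simp: E_def coeff_R.simps)
  next
    case False
    \<comment> \<open>\<open>F\<close> is \<open>E s\<close> without one factor 2, which goes into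
      the leading 1/2 of the recurrence.\<close>
    define F where "F = (2 ^ (2 * s) * fact (2 * s) :: nat)"
    have 1: "of_nat F * (coeff_R H (s - c) i k *
        ((coeff_A H d i l - coeff_A H d k l) * (coeff_A H (c - d) i l - coeff_A H (c - d) k l))) \<in> \<int>"
      if "c \<in> {1..s}" "d \<in> {0..c}" for c d l
    proof (rule Ints_mult_of_dvd)
      define G where "G = (2 ^ (2 * c - 1) * fact (2 * c) :: nat)"
      show "of_nat (E (s - c)) * coeff_R H (s - c) i k \<in> \<int>"
        using R that by simp
      show "of_nat G * ((coeff_A H d i l - coeff_A H d k l) *
          (coeff_A H (c - d) i l - coeff_A H (c - d) k l)) \<in> \<int>"
      proof (rule Ints_mult_of_dvd)
        show "of_nat (D d) * (coeff_A H d i l - coeff_A H d k l) \<in> \<int>"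
          unfolding right_diff_distrib using Ds that by (intro Ints_diff) auto
        show "of_nat (D (c - d)) * (coeff_A H (c - d) i l - coeff_A H (c - d) k l) \<in> \<int>"
          unfolding right_diff_distrib using Ds that by (intro Ints_diff) auto
        \<comment> \<open>Equality of the exponents holds at d = 0 and d = c, where one of the
          subtractions is truncated; c \<ge> 1 is used here.\<close>
        have "2 * d + 2 * (c - d) = 2 * c" "2 * d - 1 + (2 * (c - d) - 1) \<le> 2 * c - 1"
          using that by auto
        then show "D d * D (c - d) dvd G"
          unfolding D_def G_def
          using denominator_dvd[of "2 * d - 1" "2 * (c - d) - 1" "2 * c - 1" "2 * d" "2 * (c - d)"]
          by simp
      qed
      have "2 * (s - c) + 2 * c = 2 * s" "2 * (s - c) + 1 + (2 * c - 1) \<le> 2 * s"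
        using that by auto
      then show "E (s - c) * G dvd F"
        unfolding E_def G_def F_def
        using denominator_dvd[of "2 * (s - c) + 1" "2 * c - 1" "2 * s" "2 * (s - c)" "2 * c"]
        by simp
    qed
    have EF: "of_nat (E s) * (- (1 / 2)) = (- of_nat F :: rat)"
      by (simp add: E_def F_def)
    have "of_nat (E s) * coeff_R H s i k = - (of_nat F * (\<Sum>c\<in>{1..s}. coeff_R H (s - c) i k *
        (\<Sum>l<length H. \<Sum>d\<in>{0..c}. (coeff_A H d i l - coeff_A H d k l) *
          (coeff_A H (c - d) i l - coeff_A H (c - d) k l))))"
      using False by (subst coeff_R_eq) (simp_all only: mult.assoc[symmetric] EF, simp_all)
    also have "\<dots> \<in> \<int>"
      unfolding sum_distrib_left by (intro Ints_minus Ints_sum 1) auto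
    finally show ?thesis .
  qed
  then show ?case using As by (simp only: D_def E_def)
qed

section \<open>Magnitudes of the coefficients\<close>

lemma abs_sum_le:
  fixes f :: "'a \<Rightarrow> rat"
  assumes "\<And>x. x \<in> A \<Longrightarrow> \<bar>f x\<bar> \<le> B"
  shows "\<bar>sum f A\<bar> \<le> of_nat (card A) * B"
  by (rule order_trans[OF sum_abs sum_bounded_above]) (rule assms)

lemma abs_diff_le: "\<bar>a\<bar> \<le> B \<Longrightarrow> \<bar>b\<bar> \<le> B \<Longrightarrow> \<bar>a - b\<bar> \<le> 2 * (B :: rat)"
  by linarith

text \<open>In the order of evaluation each new matrix gains one factor \<open>K\<close> over the
  one before it, hence the exponents 2s - 1 for a and 2s for r. For r, the sums have at most N
  values of c, m of l and N + 1 of d; two differences contribute 4 and the prefactor 1/2, in total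
  2Nm(N+1) \<le> K. For a, the factor is m(N+1).\<close>

lemma coeff_magnitudes:
  fixes K :: rat
  assumes "s \<le> N" and K: "K \<ge> 2 * (of_nat (length H) + 1) * (of_nat N + 1)\<^sup>2"
  shows "\<bar>coeff_A H s i j\<bar> \<le> K ^ (2 * s - 1) \<and> \<bar>coeff_R H s i k\<bar> \<le> K ^ (2 * s)"
  using assms(1)
proof (induction s arbitrary: i j k rule: less_induct)
  case (less s)
  define m n :: rat where "m = of_nat (length H)" and "n = of_nat N"
  have mn: "m \<ge> 0" "n \<ge> 0" and K: "K \<ge> 2 * (m + 1) * (n + 1)\<^sup>2"
    using K by (simp_all add: m_def n_def)
  have A: "\<bar>coeff_A H t i j\<bar> \<le> K ^ (2 * t - 1)" if "t < s" for t i j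
    using less that by simp
  have R: "\<bar>coeff_R H t i k\<bar> \<le> K ^ (2 * t)" if "t < s" for t i k
    using less that by simp
  have "1 * 1 \<le> (2 * (m + 1)) * (n + 1)\<^sup>2"
    using mn by (intro mult_mono) auto
  then have K1: "K \<ge> 1" using K by simp
  have As: "\<bar>coeff_A H s i j\<bar> \<le> K ^ (2 * s - 1)" for i j
  proof (cases s)
    case 0
    then show ?thesis by simp
  next
    case (Suc t)
    have 1: "\<bar>(coeff_A H p i j - coeff_A H p k j) * coeff_R H (t - p) i k\<bar> \<le> 2 * K ^ (2 * t)"
      if "p \<in> {0..t}" for p k
    proof -
      have "\<bar>coeff_A H p i j - coeff_A H p k j\<bar> * \<bar>coeff_R H (t - p) i k\<bar> \<le>
          (2 * K ^ (2 * p - 1)) * K ^ (2 * (t - p))"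
        using A R that Suc K1 by (intro mult_mono abs_diff_le) auto
      also have "\<dots> = 2 * K ^ (2 * p - 1 + 2 * (t - p))" by (simp add: power_add)
      also have "\<dots> \<le> 2 * K ^ (2 * t)"
        using that K1 by (intro mult_left_mono power_increasing) auto
      finally show ?thesis by (simp add: abs_mult)
    qed
    have 2: "\<bar>of_bool (H ! i ! k) * (coeff_A H t i j - coeff_A H t k j)\<bar> \<le> 2 * K ^ (2 * t)" for k
    proof -
      have "\<bar>coeff_A H t i j - coeff_A H t k j\<bar> \<le> 2 * K ^ (2 * t - 1)"
        using A Suc by (intro abs_diff_le) auto
      also have "\<dots> \<le> 2 * K ^ (2 * t)"
        using K1 by (intro mult_left_mono power_increasing) auto
      finally show ?thesis using K1 by (cases "H ! i ! k") auto
    qed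
    define X Y where "X = (\<Sum>k<length H. \<Sum>p\<in>{0..t}.
        (coeff_A H p i j - coeff_A H p k j) * coeff_R H (t - p) i k)"
      and "Y = (\<Sum>k<length H. of_bool (H ! i ! k) * (coeff_A H t i j - coeff_A H t k j))"
    have "\<bar>X\<bar> \<le> of_nat (card {..<length H}) * (of_nat (card {0..t}) * (2 * K ^ (2 * t)))"
      unfolding X_def by (intro abs_sum_le 1)
    then have "\<bar>X\<bar> \<le> m * ((of_nat t + 1) * (2 * K ^ (2 * t)))"
      by (simp add: m_def add.commute)
    moreover have "\<bar>Y\<bar> \<le> of_nat (card {..<length H}) * (2 * K ^ (2 * t))"
      unfolding Y_def by (intro abs_sum_le 2)
    then have "\<bar>Y\<bar> \<le> m * (2 * K ^ (2 * t))"
      by (simp add: m_def)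
    \<comment> \<open>Since t + 1 = s \<le> N, the sum over p has at most N terms; the remaining
      unit in \<open>n + 1\<close> accounts for \<open>Y\<close>.\<close>
    moreover have "(of_nat t :: rat) + 1 \<le> n"
      using less(2) by (simp add: n_def Suc flip: of_nat_Suc)
    then have "m * ((of_nat t + 1) * (2 * K ^ (2 * t))) \<le> m * (n * (2 * K ^ (2 * t)))"
      using mn K1 by (intro mult_left_mono mult_right_mono) auto
    ultimately have XY: "\<bar>X - Y\<bar> \<le> 2 * (m * (n + 1)) * K ^ (2 * t)"
      by (simp add: algebra_simps)
    \<comment> \<open>The prefactor is at most 1/2, which cancels the 2 that comes from the
      differences.\<close>
    have "(1::rat) \<le> 1 * 1" by simp
    also have "\<dots> \<le> (of_nat t + 1) * (2 * of_nat t + 1)" by (intro mult_mono) auto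
    finally have "2 \<le> 2 * (of_nat t + 1) * (2 * of_nat t + 1 :: rat)"
      unfolding mult.assoc by linarith
    then have "\<bar>coeff_A H s i j\<bar> \<le> \<bar>X - Y\<bar> / 2"
      unfolding Suc coeff_A_Suc_eq X_def[symmetric] Y_def[symmetric] abs_mult
      by (simp add: divide_simps) (smt (verit, best) abs_ge_zero mult.commute mult_left_mono)
    also have "\<dots> \<le> m * (n + 1) * K ^ (2 * t)" using XY by simp
    also have "\<dots> \<le> K * K ^ (2 * t)"
    proof (rule mult_right_mono)
      have "m * (n + 1) \<le> 2 * (m + 1) * (n + 1)\<^sup>2"
        using mn by (simp add: power2_eq_square algebra_simps)
      then show "m * (n + 1) \<le> K" using K by linarith
    qed (use K1 in simp)
    finally show ?thesis by (simp add: Suc)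
  qed
  have Ds: "\<bar>coeff_A H t i j\<bar> \<le> K ^ (2 * t - 1)" if "t \<le> s" for t i j
    using A As that by (cases "t = s") auto
  have "\<bar>coeff_R H s i k\<bar> \<le> K ^ (2 * s)" for i k
  proof (cases "i = k \<or> s = 0")
    case True
    then show ?thesis using K1 by (auto simp: coeff_R.simps)
  next
    case False
    define W where "W c = (\<Sum>l<length H. \<Sum>d\<in>{0..c}. (coeff_A H d i l - coeff_A H d k l) *
          (coeff_A H (c - d) i l - coeff_A H (c - d) k l))" for c
    have W: "\<bar>W c\<bar> \<le> m * ((n + 1) * (4 * K ^ (2 * c - 1)))" if c: "c \<in> {1..s}" for c
    proof -
      have "\<bar>(coeff_A H d i l - coeff_A H d k l) * (coeff_A H (c - d) i l - coeff_A H (c - d) k l)\<bar>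
          \<le> 4 * K ^ (2 * c - 1)" if "d \<in> {0..c}" for d l
      proof -
        have "\<bar>coeff_A H d i l - coeff_A H d k l\<bar> * \<bar>coeff_A H (c - d) i l - coeff_A H (c - d) k l\<bar> \<le>
            (2 * K ^ (2 * d - 1)) * (2 * K ^ (2 * (c - d) - 1))"
          using Ds that c K1 by (intro mult_mono abs_diff_le) auto
        also have "\<dots> = 4 * K ^ (2 * d - 1 + (2 * (c - d) - 1))" by (simp add: power_add)
        also have "\<dots> \<le> 4 * K ^ (2 * c - 1)"
          using that c K1 by (intro mult_left_mono power_increasing) auto
        finally show ?thesis by (simp add: abs_mult)
      qed
      then have "\<bar>W c\<bar> \<le> of_nat (card {..<length H}) * (of_nat (card {0..c}) * (4 * K ^ (2 * c - 1)))"
        unfolding W_def by (intro abs_sum_le)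
      also have "\<dots> \<le> m * ((n + 1) * (4 * K ^ (2 * c - 1)))"
        using c less(2) K1 by (auto simp: m_def n_def intro!: mult_left_mono mult_right_mono)
      finally show ?thesis .
    qed
    have "\<bar>coeff_R H (s - c) i k * W c\<bar> \<le> m * ((n + 1) * (4 * K ^ (2 * s - 1)))"
      if c: "c \<in> {1..s}" for c
    proof -
      have "\<bar>coeff_R H (s - c) i k\<bar> * \<bar>W c\<bar> \<le> K ^ (2 * (s - c)) * (m * ((n + 1) * (4 * K ^ (2 * c - 1))))"
        using R W c K1 by (intro mult_mono) auto
      also have "\<dots> = m * ((n + 1) * (4 * K ^ (2 * (s - c) + (2 * c - 1))))"
        by (simp add: power_add)
      also have "2 * (s - c) + (2 * c - 1) = 2 * s - 1" using c by auto
      finally show ?thesis by (simp add: abs_mult)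
    qed
    then have "\<bar>\<Sum>c\<in>{1..s}. coeff_R H (s - c) i k * W c\<bar> \<le>
        of_nat (card {1..s}) * (m * ((n + 1) * (4 * K ^ (2 * s - 1))))"
      by (rule abs_sum_le)
    also have "\<dots> \<le> n * (m * ((n + 1) * (4 * K ^ (2 * s - 1))))"
      using less(2) mn K1 by (intro mult_right_mono) (auto simp: n_def)
    finally have "\<bar>coeff_R H s i k\<bar> \<le> 2 * (n * (m * ((n + 1) * K ^ (2 * s - 1))))"
      using False by (subst coeff_R_eq) (simp_all add: W_def abs_mult)
    also have "\<dots> = (2 * n * m * (n + 1)) * K ^ (2 * s - 1)" by simp
    also have "\<dots> \<le> K * K ^ (2 * s - 1)"
    proof (rule mult_right_mono)
      have "2 * n * m * (n + 1) \<le> 2 * (m + 1) * (n + 1)\<^sup>2"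
        using mn by (simp add: power2_eq_square algebra_simps)
      then show "2 * n * m * (n + 1) \<le> K" using K by linarith
    qed (use K1 in simp)
    also have "\<dots> = K ^ (2 * s)" using False by (metis power_minus_mult mult.commute mult_eq_0_iff neq0_conv zero_neq_numeral)
    finally show ?thesis .
  qed
  then show ?case using As by simp
qed

text \<open>The witness is the fraction with numerator Qv and denominator Q, in general not
  reduced.\<close>

lemma small_of_bounds:
  assumes "of_nat Q * v \<in> \<int>" "0 < Q" "\<bar>v\<bar> \<le> of_nat M" "Q * M \<le> 2 ^ b" "Q \<le> 2 ^ b"
  shows "small b v"
proof -
  obtain x where x: "of_nat Q * v = of_int x" using assms(1) by (auto elim: Ints_cases)
  have "of_int \<bar>x\<bar> = of_nat Q * \<bar>v\<bar>" using x by (metis abs_mult abs_of_nat of_int_abs)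
  also have "\<dots> \<le> of_nat Q * of_nat M" using assms(3) by (intro mult_left_mono) auto
  also have "\<dots> = (of_int (int (Q * M)) :: rat)" by simp
  finally have "\<bar>x\<bar> \<le> int (Q * M)" by (simp only: of_int_le_iff)
  also have "\<dots> \<le> int (2 ^ b)" using assms(4) by (simp only: of_nat_le_iff)
  finally have "\<bar>x\<bar> \<le> 2 ^ b" by simp
  moreover have "int Q \<le> int (2 ^ b)" using assms(5) by (simp only: of_nat_le_iff)
  then have "int Q \<le> 2 ^ b" by simp
  moreover have "v = of_int x / of_int (int Q)" using x assms(2) by (simp add: field_simps)
  ultimately show ?thesis using assms(2) unfolding small_def
    by (intro exI[of _ x] exI[of _ "int Q"]) auto
qed

text \<open>The summands are exponents of 2 for the three factors of the numerator bound:
  \<open>2 * N + 1\<close> for the power of 2, \<open>(2 * N)\<^sup>2\<close> for the factorial of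
  2N, and 2N times K for the power of K, each by the crude x \<le> 2^x.\<close>

definition bit_bound :: "nat \<Rightarrow> nat \<Rightarrow> nat" where
  "bit_bound m N = 2 * N + 1 + (2 * N)\<^sup>2 + 2 * N * (2 * (m + 1) * (N + 1)\<^sup>2)"

lemma small_coeffs:
  assumes "s \<le> N"
  shows "small (bit_bound (length H) N) (coeff_A H s i j)"
    and "small (bit_bound (length H) N) (coeff_R H s i k)"
proof -
  define K where "K = 2 * (length H + 1) * (N + 1)\<^sup>2"
  define E where "E = (2 ^ (2 * s + 1) * fact (2 * s) :: nat)"
  have K: "(of_nat K :: rat) \<ge> 2 * (of_nat (length H) + 1) * (of_nat N + 1)\<^sup>2"
    by (simp add: K_def algebra_simps)
  have K0: "K > 0" by (simp add: K_def)
  note m = coeff_magnitudes[OF assms K]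
  have "fact (2 * s) \<le> (2 * s) ^ (2 * s)" by (use fact_le_power[of "2 * s", where 'a = nat] in simp)
  also have "\<dots> \<le> (2 ^ (2 * s)) ^ (2 * s)" by (rule power_mono) (simp_all add: less_imp_le)
  also have "\<dots> = (2::nat) ^ (2 * s)\<^sup>2" by (simp add: power2_eq_square flip: power_mult)
  finally have f: "fact (2 * s) \<le> (2::nat) ^ (2 * s)\<^sup>2" .
  have "E * K ^ (2 * s) \<le> (2 ^ (2 * s + 1) * 2 ^ (2 * s)\<^sup>2) * (2 ^ K) ^ (2 * s)"
    unfolding E_def using f by (intro mult_mono power_mono) (simp_all add: less_imp_le)
  also have "\<dots> = 2 ^ (2 * s + 1 + (2 * s)\<^sup>2 + 2 * s * K)"
    by (simp add: power_add power_mult mult.commute flip: power_mult)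
  also have "\<dots> \<le> 2 ^ bit_bound (length H) N"
    unfolding bit_bound_def K_def[symmetric] using assms
    by (intro power_increasing add_mono mult_mono power_mono) auto
  finally have EK: "E * K ^ (2 * s) \<le> 2 ^ bit_bound (length H) N" .
  have "E * 1 \<le> E * K ^ (2 * s)" using K0 by (intro mult_left_mono) auto
  then have E: "E \<le> 2 ^ bit_bound (length H) N" using EK by linarith
  have E0: "E > 0" by (simp add: E_def)
  have "2 ^ (2 * s - 1) * fact (2 * s) dvd E"
    unfolding E_def by (intro mult_dvd_mono le_imp_power_dvd) auto
  then have A: "of_nat E * coeff_A H s i j \<in> \<int>"
    using coeff_denominators[of s H i j] Ints_of_dvd by blast
  have "(of_nat K :: rat) ^ (2 * s - 1) \<le> of_nat K ^ (2 * s)"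
    using K0 by (intro power_increasing) auto
  then have "\<bar>coeff_A H s i j\<bar> \<le> of_nat (K ^ (2 * s))"
    using m[of i j] by (auto intro: order_trans)
  then show "small (bit_bound (length H) N) (coeff_A H s i j)"
    by (rule small_of_bounds[OF A E0 _ EK E])
  have "of_nat E * coeff_R H s i k \<in> \<int>"
    using coeff_denominators[of s H] by (simp only: E_def)
  moreover have "\<bar>coeff_R H s i k\<bar> \<le> of_nat (K ^ (2 * s))"
    using m[of i _ k] by simp
  ultimately show "small (bit_bound (length H) N) (coeff_R H s i k)"
    using E0 EK E small_of_bounds by blast
qed

section \<open>The cost and correctness of the matrices\<close>

text \<open>The bound \<open>b\<close> is the same for all matrices of the list, so it does not grow
  as the table is extended.\<close>

definition reps :: "nat \<Rightarrow> nat \<Rightarrow> (nat \<Rightarrow> nat \<Rightarrow> nat \<Rightarrow> rat) \<Rightarrow> nat \<Rightarrow> bmatrix list \<Rightarrow> bool" where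
  "reps m b v s Ms \<longleftrightarrow> length Ms = s \<and>
     (\<forall>t<s. length (Ms ! t) = m \<and> (\<forall>i<m. length (Ms ! t ! i) = m \<and>
        (\<forall>j<m. rep (Ms ! t ! i ! j) (v t i j) \<and> small b (v t i j))))"

lemma reps_snoc:
  assumes "reps m b v s Ms"
    and "\<And>i j. i < m \<Longrightarrow> j < m \<Longrightarrow> rep (val (f i j)) (v s i j) \<and> small b (v s i j)"
  shows "reps m b v (Suc s) (Ms @ [val (matrix_tm m f)])"
  using assms unfolding reps_def by (auto simp: nth_append less_Suc_eq)

lemma runs_entry:
  assumes "reps m b v s Ms" "t < s" "i < m" "j < m" "t \<le> n" "m \<le> n"
  shows "runs (entry_tm Ms t i j) (v t i j) b (3 * n + 4)"
  using assms time_nth[of Ms t] time_nth[of "Ms ! t" i] time_nth[of "Ms ! t ! i" j]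
  unfolding reps_def by (simp add: runs_def entry_tm_def)

definition t_diff :: "nat \<Rightarrow> nat" where
  "t_diff n = 1 + 2 * (3 * n + 4) + t_rat n"

lemma runs_diff:
  assumes "reps m n v s Ms" "t < s" "i < m" "k < m" "j < m" "t \<le> n" "m \<le> n"
  shows "runs (diff_tm Ms t i k j) (v t i j - v t k j) (2 * n + 1) (t_diff n)"
proof -
  have x: "runs (entry_tm Ms t i j) (v t i j) n (3 * n + 4)"
    and y: "runs (entry_tm Ms t k j) (v t k j) n (3 * n + 4)"
    using assms by (auto intro!: runs_entry)
  then have "runs (sub_rat_tm (val (entry_tm Ms t i j)) (val (entry_tm Ms t k j)))
      (v t i j - v t k j) (Suc (n + n)) (t_rat n)"
    by (intro runs_sub) (auto simp: runs_def)
  with x y show ?thesis by (simp add: runs_def diff_tm_def t_diff_def mult_2)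
qed

text \<open>From here on, a single \<open>n\<close> bounds the number of vertices, the index and the
  length of stored entries. A difference of two entries has length at most \<open>2 * n + 1\<close>,
  a product of two such differences \<open>4 * n + 2\<close>, and the sum over d has at most
  \<open>Suc n\<close> terms.\<close>

definition b_dist_inner :: "nat \<Rightarrow> nat" where
  "b_dist_inner n = Suc n * Suc (4 * n + 2)"

definition b_dist :: "nat \<Rightarrow> nat" where
  "b_dist n = n * Suc (b_dist_inner n)"

definition t_dist_inner :: "nat \<Rightarrow> nat" where
  "t_dist_inner n =
     Suc n * (1 + (2 * t_diff n + Suc n + t_rat (2 * n + 1)) + t_rat (b_dist_inner n)) + 1"

definition t_dist :: "nat \<Rightarrow> nat" where
  "t_dist n = 1 + Suc n + Suc (Suc n) + (n * (1 + t_dist_inner n + t_rat (b_dist n)) + 1)"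

lemma runs_dist_coeff:
  assumes As: "reps m n a s As" and "c < s" "i < m" "k < m" "c \<le> n" "m \<le> n"
  shows "runs (dist_coeff_tm As m c i k)
    (\<Sum>l<m. \<Sum>d\<in>{0..c}. (a d i l - a d k l) * (a (c - d) i l - a (c - d) k l)) (b_dist n) (t_dist n)"
proof -
  define f where "f l d = do {
       x \<leftarrow> diff_tm As d i k l;
       c' \<leftarrow> minus_nat_tm c d;
       y \<leftarrow> diff_tm As c' i k l;
       mult_rat_tm x y }" for l d
  define v where "v l d = (a d i l - a d k l) * (a (c - d) i l - a (c - d) k l)" for l d
  have f: "runs (f l d) (v l d) (4 * n + 2) (2 * t_diff n + Suc n + t_rat (2 * n + 1))"
    if "d \<le> c" "l < m" for l d
  proof -
    have x: "runs (diff_tm As d i k l) (a d i l - a d k l) (2 * n + 1) (t_diff n)"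
      and y: "runs (diff_tm As (c - d) i k l) (a (c - d) i l - a (c - d) k l) (2 * n + 1) (t_diff n)"
      using assms that by (intro runs_diff[OF As]; simp)+
    then have "runs (mult_rat_tm (val (diff_tm As d i k l)) (val (diff_tm As (c - d) i k l)))
        (v l d) ((2 * n + 1) + (2 * n + 1)) (t_rat (2 * n + 1))"
      unfolding v_def by (intro runs_mult) (auto simp: runs_def)
    moreover have "(2 * n + 1) + (2 * n + 1) = 4 * n + 2" by simp
    ultimately show ?thesis
      using x y time_minus_nat[of c d] that assms(5) by (simp add: runs_def f_def)
  qed
  have "runs (sum_tm (f l) [0..<Suc c]) (sum_list (map (v l) [0..<Suc c]))
      (b_dist_inner n) (t_dist_inner n)" if "l < m" for l
    unfolding b_dist_inner_def t_dist_inner_def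
    by (rule runs_sum) (use f that assms(5) in auto)
  then have "runs (sum_tm (\<lambda>l. sum_tm (f l) [0..<Suc c]) [0..<m])
      (sum_list (map (\<lambda>l. sum_list (map (v l) [0..<Suc c])) [0..<m]))
      (b_dist n) (n * (1 + t_dist_inner n + t_rat (b_dist n)) + 1)"
    unfolding b_dist_def by (intro runs_sum) (use assms(6) in auto)
  moreover have "sum_list (map (\<lambda>l. sum_list (map (v l) [0..<Suc c])) [0..<m]) =
      (\<Sum>l<m. \<Sum>d\<in>{0..c}. v l d)"
    by (simp only: sum_set_upt_conv_sum_list_nat[symmetric] atLeast0LessThan
        atLeastLessThanSuc_atLeastAtMost set_upt)
  ultimately show ?thesis
    using assms(5,6) unfolding v_def
    by (simp add: runs_def dist_coeff_tm_def f_def[symmetric] t_dist_def del: upt_Suc)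
qed

definition b_R :: "nat \<Rightarrow> nat" where
  "b_R n = n * Suc (n + b_dist n)"

definition t_R :: "nat \<Rightarrow> nat" where
  "t_R n = 1 + Suc n + Suc n +
     (n * (1 + (Suc n + (3 * n + 4) + t_dist n + t_rat (n + b_dist n)) + t_rat (b_R n)) + 1) +
     t_rat (1 + b_R n)"

text \<open>No length is claimed for the result. The one obtained along the computation exceeds
  \<open>n\<close> and would compound from stage to stage; the length of a stored entry comes from
  \<open>small_coeffs\<close> instead.\<close>

lemma runs_R_entry:
  assumes As: "reps (length H) n (coeff_A H) (Suc s) As" and Rs: "reps (length H) n (coeff_R H) s Rs"
    and "i < length H" "k < length H" "s \<le> n" "length H \<le> n"
  shows "rep (val (R_entry_tm As Rs (length H) s i k)) (coeff_R H s i k)"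
    and "time (R_entry_tm As Rs (length H) s i k) \<le> t_R n"
proof -
  have e: "time (eq_nat_tm i k) \<le> Suc n"
    using time_eq_nat[of i k] assms by linarith
  have "rep (val (R_entry_tm As Rs (length H) s i k)) (coeff_R H s i k) \<and>
    time (R_entry_tm As Rs (length H) s i k) \<le> t_R n"
  proof (cases "i = k \<or> s = 0")
    case True
    then show ?thesis using e
      by (auto simp: R_entry_tm_def t_R_def coeff_R.simps rep_def rat_of_brat_eq)
  next
    case False
    define f where "f c = do {
            c' \<leftarrow> minus_nat_tm s c;
            r \<leftarrow> entry_tm Rs c' i k;
            w \<leftarrow> dist_coeff_tm As (length H) c i k;
            mult_rat_tm r w }" for c
    define W where "W c = (\<Sum>l<length H. \<Sum>d\<in>{0..c}. (coeff_A H d i l - coeff_A H d k l) *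
          (coeff_A H (c - d) i l - coeff_A H (c - d) k l))" for c
    define v where "v c = coeff_R H (s - c) i k * W c" for c
    have f: "runs (f c) (v c) (n + b_dist n)
        (Suc n + (3 * n + 4) + t_dist n + t_rat (n + b_dist n))" if "c \<in> {1..s}" for c
    proof -
      have x: "runs (entry_tm Rs (s - c) i k) (coeff_R H (s - c) i k) n (3 * n + 4)"
        using assms that by (auto intro!: runs_entry[OF Rs])
      have y: "runs (dist_coeff_tm As (length H) c i k) (W c) (b_dist n) (t_dist n)"
        unfolding W_def using assms that by (intro runs_dist_coeff[OF As]) auto
      have "runs (mult_rat_tm (val (entry_tm Rs (s - c) i k)) (val (dist_coeff_tm As (length H) c i k)))
        (v c) (n + b_dist n) (t_rat (n + b_dist n))"
        unfolding v_def using x y by (intro runs_mult) (auto simp: runs_def)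
      with x y show ?thesis
        using time_minus_nat[of s c] that assms(5) by (simp add: runs_def f_def)
    qed
    have S: "runs (sum_tm f [Suc 0..<Suc s]) (sum_list (map v [Suc 0..<Suc s])) (b_R n)
        (n * (1 + (Suc n + (3 * n + 4) + t_dist n + t_rat (n + b_dist n)) + t_rat (b_R n)) + 1)"
      unfolding b_R_def by (rule runs_sum) (use f assms(5) in auto)
    have "rep (BNeg num.One, num.Bit0 num.One) (- (1 / 2))"
      by (simp add: rep_def rat_of_brat_eq)
    moreover have "small 1 (- (1 / 2))"
      unfolding small_def by (intro exI[of _ "-1"] exI[of _ 2]) simp
    ultimately have M: "runs (mult_rat_tm (BNeg num.One, num.Bit0 num.One) (val (sum_tm f [Suc 0..<Suc s])))
        (- (1 / 2) * sum_list (map v [Suc 0..<Suc s])) (1 + b_R n) (t_rat (1 + b_R n))"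
      using S by (intro runs_mult) (auto simp: runs_def)
    have "sum_list (map v [Suc 0..<Suc s]) = (\<Sum>c\<in>{1..s}. v c)"
      by (simp only: sum_set_upt_conv_sum_list_nat[symmetric]
          atLeastLessThanSuc_atLeastAtMost set_upt One_nat_def)
    then have "coeff_R H s i k = - (1 / 2) * sum_list (map v [Suc 0..<Suc s])"
      unfolding v_def W_def using False by (subst coeff_R_eq) simp_all
    with M S show ?thesis
      using e False assms(5)
      by (simp add: runs_def R_entry_tm_def f_def[symmetric] t_R_def nat.case_eq_if del: upt_Suc)
  qed
  then show "rep (val (R_entry_tm As Rs (length H) s i k)) (coeff_R H s i k)"
    "time (R_entry_tm As Rs (length H) s i k) \<le> t_R n" by blast+
qed

definition t_factor :: "nat \<Rightarrow> nat" where
  "t_factor n = 1 + (n + 1) * (n + 2) + Suc n + (2 * n + 1) * (2 * n + 2) + t_rat (2 * n + 1)"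

text \<open>The numerator is 1, so the fraction is in lowest terms without a reduction. The
  denominator has size at most \<open>3 * s + 2\<close>, which explains
  \<open>3 * n + 3\<close>.\<close>

lemma runs_factor:
  assumes "s \<le> n"
  shows "runs (factor_tm s) (1 / (2 * (of_nat s + 1) * (2 * of_nat s + 1))) (3 * n + 3) (t_factor n)"
proof -
  define x where "x = val (num_of_Suc_tm s)"
  define y where "y = val (num_of_Suc_tm (s + s))"
  have sz: "size x \<le> s" "size y \<le> s + s"
    using size_num_of_Suc by (simp_all add: x_def y_def)
  have "rep (val (factor_tm s)) (1 / (2 * (of_nat s + 1) * (2 * of_nat s + 1)))"
    by (simp add: factor_tm_def rep_def rat_of_brat_eq algebra_simps)
  moreover have "small (3 * n + 3) (1 / (2 * (of_nat s + 1) * (2 * of_nat s + 1)))"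
  proof (rule small_of_rep)
    show "size (snd (val (factor_tm s))) < 3 * n + 3"
      using size_mult_num[of "num.Bit0 x" y] sz assms
      by (simp add: factor_tm_def x_def[symmetric] y_def[symmetric])
  qed (fact, simp add: factor_tm_def)
  moreover have "time (factor_tm s) \<le> t_factor n"
  proof -
    have "time (num_of_Suc_tm s) \<le> (s + 1) * (s + 2)" by (rule time_num_of_Suc)
    also have "\<dots> \<le> (n + 1) * (n + 2)" using assms by (intro mult_mono) auto
    finally have 1: "time (num_of_Suc_tm s) \<le> (n + 1) * (n + 2)" .
    have "time (num_of_Suc_tm (s + s)) \<le> (s + s + 1) * (s + s + 2)" by (rule time_num_of_Suc)
    also have "\<dots> \<le> (2 * n + 1) * (2 * n + 2)" using assms by (intro mult_mono) auto
    finally have 2: "time (num_of_Suc_tm (s + s)) \<le> (2 * n + 1) * (2 * n + 2)" .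
    have "time (mult_num_tm (num.Bit0 x) y) \<le> Suc (2 * n + 1) * Suc ((3 * (2 * n + 1) + 4)\<^sup>2)"
      by (rule time_mult_num_le) (use sz assms in auto)
    also have "\<dots> \<le> t_rat (2 * n + 1)"
      by (simp only: t_rat_def) simp
    finally have 3: "time (mult_num_tm (num.Bit0 x) y) \<le> t_rat (2 * n + 1)" .
    have "time (factor_tm s) =
        1 + time (num_of_Suc_tm s) + Suc s + time (num_of_Suc_tm (s + s)) + time (mult_num_tm (num.Bit0 x) y)"
      by (simp add: factor_tm_def x_def y_def)
    also have "\<dots> \<le> t_factor n"
      unfolding t_factor_def using 1 2 3 assms by linarith
    finally show ?thesis .
  qed
  ultimately show ?thesis by (simp add: runs_def)
qed

definition b_A_inner :: "nat \<Rightarrow> nat" where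
  "b_A_inner n = Suc n * Suc (3 * n + 1)"

definition b_A :: "nat \<Rightarrow> nat" where
  "b_A n = n * Suc (b_A_inner n)"

text \<open>An entry of the adjacency matrix is 0 or 1 and satisfies \<open>small 0\<close>, so the
  product is as long as the difference, \<open>2 * n + 1\<close>.\<close>

definition b_H :: "nat \<Rightarrow> nat" where
  "b_H n = n * Suc (2 * n + 1)"

definition t_A_inner :: "nat \<Rightarrow> nat" where
  "t_A_inner n =
     Suc n * (1 + (t_diff n + Suc n + (3 * n + 4) + t_rat (2 * n + 1)) + t_rat (b_A_inner n)) + 1"

definition t_A :: "nat \<Rightarrow> nat" where
  "t_A n = 1 + Suc n + Suc (Suc n) + (n * (1 + t_A_inner n + t_rat (b_A n)) + 1) +
     (n * (1 + (2 * Suc n + t_diff n + t_rat (2 * n + 1)) + t_rat (b_H n)) + 1) +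
     t_rat (b_A n + b_H n) + t_factor n + t_rat (b_A n + b_H n + 3 * n + 3)"

lemma runs_A_entry:
  assumes As: "reps (length H) n (coeff_A H) (Suc s) As"
    and Rs: "reps (length H) n (coeff_R H) (Suc s) Rs"
    and H: "\<forall>row\<in>set H. length row = length H"
    and "i < length H" "j < length H" "s \<le> n" "length H \<le> n"
  shows "rep (val (A_entry_tm H As Rs (length H) s i j)) (coeff_A H (Suc s) i j)"
    and "time (A_entry_tm H As Rs (length H) s i j) \<le> t_A n"
proof -
  let ?m = "length H"
  define f where "f k p = do {
            u \<leftarrow> diff_tm As p i k j;
            p' \<leftarrow> minus_nat_tm s p;
            r \<leftarrow> entry_tm Rs p' i k;
            mult_rat_tm u r }" for k p
  define g where "g k = do {
            row \<leftarrow> nth_tm H i;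
            h \<leftarrow> nth_tm row k;
            u \<leftarrow> diff_tm As s i k j;
            mult_rat_tm (if h then BPos num.One else BZero, num.One) u }" for k
  define v where "v k p = (coeff_A H p i j - coeff_A H p k j) * coeff_R H (s - p) i k" for k p
  define w where "w k = of_bool (H ! i ! k) * (coeff_A H s i j - coeff_A H s k j)" for k
  have f: "runs (f k p) (v k p) (3 * n + 1) (t_diff n + Suc n + (3 * n + 4) + t_rat (2 * n + 1))"
    if "p \<le> s" "k < ?m" for k p
  proof -
    have x: "runs (diff_tm As p i k j) (coeff_A H p i j - coeff_A H p k j) (2 * n + 1) (t_diff n)"
      using assms that by (intro runs_diff[OF As]; simp)+
    have y: "runs (entry_tm Rs (s - p) i k) (coeff_R H (s - p) i k) n (3 * n + 4)"
      using assms that by (auto intro!: runs_entry[OF Rs])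
    have "runs (mult_rat_tm (val (diff_tm As p i k j)) (val (entry_tm Rs (s - p) i k)))
        (v k p) ((2 * n + 1) + n) (t_rat (2 * n + 1))"
      unfolding v_def using x y by (intro runs_mult) (auto simp: runs_def)
    moreover have "(2 * n + 1) + n = 3 * n + 1" by simp
    ultimately show ?thesis
      using x y time_minus_nat[of s p] that assms(6) by (simp add: runs_def f_def)
  qed
  have g: "runs (g k) (w k) (2 * n + 1) (2 * Suc n + t_diff n + t_rat (2 * n + 1))" if "k < ?m" for k
  proof -
    have x: "runs (diff_tm As s i k j) (coeff_A H s i j - coeff_A H s k j) (2 * n + 1) (t_diff n)"
      using assms that by (intro runs_diff[OF As]; simp)+
    have r: "length (H ! i) = ?m" using H assms(4) by simp
    have h: "rep (if H ! i ! k then BPos num.One else BZero, num.One) (of_bool (H ! i ! k))"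
      "small 0 (of_bool (H ! i ! k))"
      using rep_0 rep_1 by auto
    have "runs (mult_rat_tm (if H ! i ! k then BPos num.One else BZero, num.One) (val (diff_tm As s i k j)))
        (w k) (0 + (2 * n + 1)) (t_rat (2 * n + 1))"
      unfolding w_def by (rule runs_mult[OF h]) (use x in \<open>auto simp: runs_def\<close>)
    then show ?thesis
      using x r that assms(4,7) time_nth[of H i] time_nth[of "H ! i" k] by (simp add: runs_def g_def)
  qed
  define X where "X = sum_tm (\<lambda>k. sum_tm (f k) [0..<Suc s]) [0..<?m]"
  define Y where "Y = sum_tm g [0..<?m]"
  define xv where "xv = sum_list (map (\<lambda>k. sum_list (map (v k) [0..<Suc s])) [0..<?m])"
  define yv where "yv = sum_list (map w [0..<?m])"
  have "runs (sum_tm (f k) [0..<Suc s]) (sum_list (map (v k) [0..<Suc s]))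
      (b_A_inner n) (t_A_inner n)" if "k < ?m" for k
    unfolding b_A_inner_def t_A_inner_def
    by (rule runs_sum) (use f that assms(6) in auto)
  then have X: "runs X xv (b_A n) (n * (1 + t_A_inner n + t_rat (b_A n)) + 1)"
    unfolding b_A_def X_def xv_def by (intro runs_sum) (use assms(7) in auto)
  have Y: "runs Y yv (b_H n) (n * (1 + (2 * Suc n + t_diff n + t_rat (2 * n + 1)) + t_rat (b_H n)) + 1)"
    unfolding b_H_def Y_def yv_def by (rule runs_sum) (use g assms(7) in auto)
  have Z: "runs (sub_rat_tm (val X) (val Y)) (xv - yv) (Suc (b_A n + b_H n)) (t_rat (b_A n + b_H n))"
    using X Y by (intro runs_sub) (auto simp: runs_def)
  define F where "F = (1 / (2 * (of_nat s + 1) * (2 * of_nat s + 1)) :: rat)"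
  have F: "runs (factor_tm s) F (3 * n + 3) (t_factor n)"
    unfolding F_def using assms(6) by (rule runs_factor)
  have M: "runs (mult_rat_tm (val (factor_tm s)) (val (sub_rat_tm (val X) (val Y))))
      (F * (xv - yv)) ((3 * n + 3) + Suc (b_A n + b_H n)) (t_rat (b_A n + b_H n + 3 * n + 3))"
    using F Z by (intro runs_mult) (auto simp: runs_def)
  have "xv = (\<Sum>k<?m. \<Sum>p\<in>{0..s}. v k p)" "yv = (\<Sum>k<?m. w k)"
    unfolding xv_def yv_def
    by (simp_all only: sum_set_upt_conv_sum_list_nat[symmetric] atLeast0LessThan
        atLeastLessThanSuc_atLeastAtMost set_upt)
  then have c: "coeff_A H (Suc s) i j = F * (xv - yv)"
    by (simp only: coeff_A_Suc_eq F_def v_def w_def)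
  \<comment> \<open>The program is restated with its summands folded into \<open>f\<close> and
    \<open>g\<close>, so that the facts about whole sums apply to it.\<close>
  have eq: "A_entry_tm H As Rs ?m s i j = do {
     tick;
     ks \<leftarrow> range_tm 0 ?m;
     ps \<leftarrow> range_tm 0 (Suc s);
     x \<leftarrow> sum_tm (\<lambda>k. sum_tm (f k) ps) ks;
     y \<leftarrow> sum_tm g ks;
     z \<leftarrow> sub_rat_tm x y;
     f \<leftarrow> factor_tm s;
     mult_rat_tm f z }"
    by (simp only: A_entry_tm_def f_def[abs_def] g_def[abs_def])
  show "rep (val (A_entry_tm H As Rs ?m s i j)) (coeff_A H (Suc s) i j)"
    using M unfolding c eq by (simp add: runs_def X_def Y_def del: upt_Suc)
  show "time (A_entry_tm H As Rs ?m s i j) \<le> t_A n"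
    using M F X Y Z assms(6,7) unfolding eq
    by (simp add: runs_def X_def[symmetric] Y_def[symmetric] t_A_def del: upt_Suc)
qed

definition t_matrix :: "nat \<Rightarrow> nat \<Rightarrow> nat" where
  "t_matrix n T = n + n * (n * Suc T + 2) + 3"

lemma time_matrix_le:
  assumes "\<And>i j. i < m \<Longrightarrow> j < m \<Longrightarrow> time (f i j) \<le> T" "m \<le> n"
  shows "time (matrix_tm m f) \<le> t_matrix n T"
proof -
  have "time (matrix_tm m f) \<le> m + m * (m * Suc T + 2) + 3"
    using assms(1) by (rule time_matrix)
  also have "\<dots> \<le> t_matrix n T"
    unfolding t_matrix_def using assms(2) by (intro add_mono mult_mono) auto
  finally show ?thesis .
qed

text \<open>The summand \<open>t_matrix n (Suc n)\<close> pays for the identity matrix, so that the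
  base case and each later stage share one bound.\<close>

definition t_step :: "nat \<Rightarrow> nat" where
  "t_step n = 2 * n + 5 + t_matrix n (Suc n) + t_matrix n (t_R n) + t_matrix n (t_A n)"

text \<open>The bounds on the true coefficients enter as hypotheses. With them every stage works on
  entries of length at most the same \<open>n\<close>, so the costs of the stages merely add
  up.\<close>

lemma tables_correct:
  assumes H: "\<forall>row\<in>set H. length row = length H"
    and small: "\<And>s i j. s \<le> N \<Longrightarrow> small n (coeff_A H s i j)"
      "\<And>s i j. s \<le> N \<Longrightarrow> small n (coeff_R H s i j)"
    and n: "N \<le> n" "length H \<le> n" and "s \<le> N"
  shows "reps (length H) n (coeff_A H) (Suc s) (fst (val (tables_tm H (length H) s)))"
    and "time (tables_tm H (length H) s) \<le> Suc s * t_step n"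
proof -
  let ?m = "length H"
  have "reps ?m n (coeff_A H) (Suc s) (fst (val (tables_tm H ?m s))) \<and>
    reps ?m n (coeff_R H) s (snd (val (tables_tm H ?m s))) \<and>
    time (tables_tm H ?m s) \<le> Suc s * t_step n"
    using \<open>s \<le> N\<close>
  proof (induction s)
    case 0
    define f where "f i j = do {
            e \<leftarrow> eq_nat_tm i j;
            return (if e then BPos num.One else BZero, num.One) }" for i j
    have "reps ?m n (coeff_A H) 0 []" "reps ?m n (coeff_R H) 0 []" by (simp_all add: reps_def)
    moreover from this(1) have "reps ?m n (coeff_A H) (Suc 0) ([] @ [val (matrix_tm ?m f)])"
      by (rule reps_snoc) (auto simp: f_def rep_0 rep_1)
    moreover have "time (f i j) \<le> Suc n" if "i < ?m" for i j
      using time_eq_nat[of i j] that n(2) by (simp add: f_def)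
    then have "time (matrix_tm ?m f) \<le> t_matrix n (Suc n)"
      using n(2) by (intro time_matrix_le)
    ultimately show ?case
      by (simp add: f_def[symmetric] t_step_def)
  next
    case (Suc s)
    obtain As Rs where AR: "val (tables_tm H ?m s) = (As, Rs)" by fastforce
    have s: "s \<le> n" "s \<le> N" using Suc(2) n by auto
    have As: "reps ?m n (coeff_A H) (Suc s) As" and Rs: "reps ?m n (coeff_R H) s Rs"
      and t: "time (tables_tm H ?m s) \<le> Suc s * t_step n"
      using Suc AR by auto
    define R where "R = val (matrix_tm ?m (R_entry_tm As Rs ?m s))"
    have Rs': "reps ?m n (coeff_R H) (Suc s) (Rs @ [R])"
      unfolding R_def using Rs
      by (rule reps_snoc) (use runs_R_entry(1)[OF As Rs] s n small in auto)
    define A where "A = val (matrix_tm ?m (A_entry_tm H As (Rs @ [R]) ?m s))"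
    have As': "reps ?m n (coeff_A H) (Suc (Suc s)) (As @ [A])"
      unfolding A_def using As
      by (rule reps_snoc) (use runs_A_entry(1)[OF As Rs' H] s n small Suc(2) in auto)
    have "time (matrix_tm ?m (R_entry_tm As Rs ?m s)) \<le> t_matrix n (t_R n)"
      by (rule time_matrix_le) (use runs_R_entry(2)[OF As Rs] s n in auto)
    moreover have "time (matrix_tm ?m (A_entry_tm H As (Rs @ [R]) ?m s)) \<le> t_matrix n (t_A n)"
      by (rule time_matrix_le) (use runs_A_entry(2)[OF As Rs' H] s n in auto)
    moreover have "length As = Suc s" "length Rs = s"
      using As Rs by (auto simp: reps_def)
    ultimately have "time (tables_tm H ?m (Suc s)) \<le> Suc (Suc s) * t_step n"
      using t s by (simp add: AR R_def[symmetric] t_step_def del: val_matrix)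
    with As' Rs' show ?case
      by (simp add: AR R_def[symmetric] A_def[symmetric] del: val_matrix)
  qed
  then show "reps ?m n (coeff_A H) (Suc s) (fst (val (tables_tm H ?m s)))"
    "time (tables_tm H ?m s) \<le> Suc s * t_step n" by blast+
qed

section \<open>The cost and correctness of the classes\<close>

lemma val_remove: "val (remove_tm x ys) = (if x \<in> set ys then Some (remove1 x ys) else None)"
  by (induction ys) auto

lemma time_remove:
  assumes "isize (fst x) \<le> b" "size (snd x) \<le> b"
  shows "time (remove_tm x ys) \<le> length ys * (2 * b + 5) + 1"
proof (induction ys)
  case (Cons y ys)
  then show ?case using time_eq_rat[OF assms, of y] by (cases "x = y") simp_all
qed simp

text \<open>Each entry of \<open>xs\<close> deletes one equal entry from \<open>ys\<close>; all
  deletions succeed and leave nothing exactly when the multisets agree.\<close>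

lemma val_perm_equiv: "val (perm_equiv_tm xs ys) \<longleftrightarrow> mset xs = mset ys"
proof (induction xs arbitrary: ys)
  case Nil
  then show ?case by (cases ys) auto
next
  case (Cons x xs)
  show ?case
  proof (cases "x \<in> set ys")
    case True
    then have "mset xs = mset (remove1 x ys) \<longleftrightarrow> add_mset x (mset xs) = mset ys"
      by (metis add_mset_add_mset_same_iff insert_DiffM mset_remove1 set_mset_mset)
    then show ?thesis using True by (simp add: val_remove Cons del: mset_remove1)
  next
    case False
    then have "mset ys \<noteq> add_mset x (mset xs)" by (metis set_mset_mset union_single_eq_member)
    then show ?thesis using False by (auto simp: val_remove)
  qed
qed

lemma time_perm_equiv:
  assumes "\<And>x. x \<in> set xs \<Longrightarrow> isize (fst x) \<le> b \<and> size (snd x) \<le> b" "length ys \<le> l"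
  shows "time (perm_equiv_tm xs ys) \<le> length xs * (l * (2 * b + 5) + 2) + 1"
  using assms
proof (induction xs arbitrary: ys)
  case (Cons x xs)
  have "time (remove_tm x ys) \<le> length ys * (2 * b + 5) + 1"
    by (rule time_remove) (use Cons(2) in auto)
  also have "\<dots> \<le> l * (2 * b + 5) + 1"
    using Cons(3) by (intro add_right_mono mult_right_mono) auto
  finally have 1: "time (remove_tm x ys) \<le> l * (2 * b + 5) + 1" .
  have "length (remove1 x ys) \<le> l"
    using Cons(3) by (auto simp: length_remove1)
  then have 2: "time (perm_equiv_tm xs (remove1 x ys)) \<le> length xs * (l * (2 * b + 5) + 2) + 1"
    using Cons(1)[of "remove1 x ys"] Cons(2) by simp
  show ?case
  proof (cases "x \<in> set ys")
    case True
    then show ?thesis using 1 2 by (simp add: val_remove)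
  next
    case False
    then show ?thesis using 1 by (simp add: val_remove)
  qed
qed simp

lemma val_same_class:
  assumes "\<And>A. A \<in> set As \<Longrightarrow> i < length A \<and> j < length A"
  shows "val (same_class_tm As i j) \<longleftrightarrow> (\<forall>A\<in>set As. mset (A ! i) = mset (A ! j))"
  using assms by (induction As) (auto simp: val_perm_equiv)

lemma time_same_class:
  assumes "\<And>A. A \<in> set As \<Longrightarrow> i < length A \<and> j < length A \<and>
    time (perm_equiv_tm (A ! i) (A ! j)) \<le> T"
  shows "time (same_class_tm As i j) \<le> length As * (i + j + T + 3) + 1"
  using assms
proof (induction As)
  case (Cons A As)
  have "time (same_class_tm As i j) \<le> length As * (i + j + T + 3) + 1"
    using Cons by simp
  moreover have "i < length A \<and> j < length A \<and> time (perm_equiv_tm (A ! i) (A ! j)) \<le> T"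
    using Cons(2) by simp
  ultimately show ?case
    using time_nth[of A i] time_nth[of A j] by simp
qed simp

text \<open>On fractions in lowest terms the value determines the representation, so comparing
  representations is the same as comparing rational numbers. The map \<open>g\<close> is the
  inverse.\<close>

lemma mset_map_rat_of_brat_eq_iff:
  assumes "\<And>q. q \<in> set xs \<union> set ys \<Longrightarrow> rep q (rat_of_brat q)"
  shows "mset (map rat_of_brat xs) = mset (map rat_of_brat ys) \<longleftrightarrow> mset xs = mset ys"
proof
  define g where "g v = (THE q. rep q v)" for v
  have g: "g (rat_of_brat q) = q" if "q \<in> set xs \<union> set ys" for q
    unfolding g_def using assms[OF that] rep_unique by blast
  assume "mset (map rat_of_brat xs) = mset (map rat_of_brat ys)"
  then have "mset (map g (map rat_of_brat xs)) = mset (map g (map rat_of_brat ys))"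
    by (metis mset_map)
  moreover have "map g (map rat_of_brat xs) = xs" "map g (map rat_of_brat ys) = ys"
    using g by (auto intro: map_idI)
  ultimately show "mset xs = mset ys" by (simp only:)
qed (metis mset_map)

text \<open>In terms of multisets the relation is visibly an equivalence, and it is what the
  deletion test decides.\<close>

lemma rows_perm_equiv_iff:
  "rows_perm_equiv H s i j \<longleftrightarrow>
    mset (map (coeff_A H s i) [0..<length H]) = mset (map (coeff_A H s j) [0..<length H])"
    (is "_ \<longleftrightarrow> mset (?r i) = mset (?r j)")
proof
  assume "rows_perm_equiv H s i j"
  then obtain p where p: "p permutes {..<length H}"
      "\<forall>l<length H. coeff_A H s j l = coeff_A H s i (p l)"
    by (auto simp: rows_perm_equiv_def)
  have "?r j = permute_list p (?r i)"
    using p permutes_in_image[OF p(1)] by (auto simp: permute_list_def)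
  then show "mset (?r i) = mset (?r j)"
    using p(1) by (metis mset_permute_list length_map length_upt diff_zero)
next
  assume "mset (?r i) = mset (?r j)"
  then obtain p where p: "p permutes {..<length (?r i)}" "permute_list p (?r i) = ?r j"
    using mset_eq_permutation by metis
  have "coeff_A H s j l = coeff_A H s i (p l)" if "l < length H" for l
  proof -
    have "p l < length H" using p(1) that permutes_in_image[OF p(1), of l] by simp
    moreover have "?r j ! l = permute_list p (?r i) ! l" using p(2) by simp
    ultimately show ?thesis using that by (simp add: permute_list_def)
  qed
  then show "rows_perm_equiv H s i j" using p(1) by (auto simp: rows_perm_equiv_def)
qed

lemma rep_rat_of_brat: "rep q v \<Longrightarrow> rat_of_brat q = v"
  by (simp add: rep_def)

lemma reps_row:
  assumes "reps m b v s Ms" "t < s" "i < m"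
  shows "map rat_of_brat (Ms ! t ! i) = map (v t i) [0..<m]"
  using assms unfolding reps_def by (auto intro!: nth_equalityI rep_rat_of_brat)

definition t_same :: "nat \<Rightarrow> nat" where
  "t_same n = Suc n * (2 * n + (n * (n * (2 * n + 5) + 2) + 1) + 3) + 1"

lemma same_class_correct:
  assumes As: "reps (length H) n (coeff_A H) (Suc ((length H)\<^sup>2)) As"
    and "i < length H" "j < length H" "length H \<le> n" "(length H)\<^sup>2 \<le> n"
  shows "val (same_class_tm As i j) \<longleftrightarrow> (i, j) \<in> same_class_rel H"
    and "time (same_class_tm As i j) \<le> t_same n"
proof -
  have l: "length As = Suc ((length H)\<^sup>2)" using As by (simp add: reps_def)
  have A: "length A = length H" if "A \<in> set As" for A
    using As that by (auto simp: reps_def in_set_conv_nth)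
  have row: "length (A ! k) = length H" "\<And>q. q \<in> set (A ! k) \<Longrightarrow> \<exists>v. rep q v \<and> small n v"
    if A': "A \<in> set As" and k: "k < length H" for A k
  proof -
    obtain t where t: "t < length As" "A = As ! t" using A' by (auto simp: in_set_conv_nth)
    show "length (A ! k) = length H" using As t k l by (simp add: reps_def)
    fix q assume "q \<in> set (A ! k)"
    then obtain c where "c < length H" "q = As ! t ! k ! c"
      using \<open>length (A ! k) = length H\<close> t by (auto simp: in_set_conv_nth)
    then show "\<exists>v. rep q v \<and> small n v" using As t k l by (auto simp: reps_def)
  qed
  have "mset (As ! t ! i) = mset (As ! t ! j) \<longleftrightarrow> rows_perm_equiv H t i j"
    if "t < Suc ((length H)\<^sup>2)" for t
  proof -
    have "As ! t \<in> set As" using l that by simp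
    then have "rep q (rat_of_brat q)" if "q \<in> set (As ! t ! i) \<union> set (As ! t ! j)" for q
      using row(2)[of "As ! t"] that assms(2,3) rep_rat_of_brat by blast
    then show ?thesis
      unfolding rows_perm_equiv_iff reps_row[OF As that assms(2), symmetric]
        reps_row[OF As that assms(3), symmetric]
      by (rule mset_map_rat_of_brat_eq_iff[symmetric])
  qed
  then have "(\<forall>A\<in>set As. mset (A ! i) = mset (A ! j)) \<longleftrightarrow>
      (\<forall>t<Suc ((length H)\<^sup>2). rows_perm_equiv H t i j)"
    by (simp add: all_set_conv_all_nth l)
  moreover have "val (same_class_tm As i j) \<longleftrightarrow> (\<forall>A\<in>set As. mset (A ! i) = mset (A ! j))"
    by (rule val_same_class) (use A assms(2,3) in simp)
  ultimately show "val (same_class_tm As i j) \<longleftrightarrow> (i, j) \<in> same_class_rel H"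
    using assms(2,3) by (auto simp: same_class_rel_def less_Suc_eq_le)
  have "time (same_class_tm As i j) \<le>
      length As * (i + j + (length H * (length H * (2 * n + 5) + 2) + 1) + 3) + 1"
  proof (intro time_same_class conjI)
    fix A assume "A \<in> set As"
    then show "i < length A" "j < length A" using A assms(2,3) by auto
    have "time (perm_equiv_tm (A ! i) (A ! j)) \<le> length (A ! i) * (length H * (2 * n + 5) + 2) + 1"
      by (rule time_perm_equiv) (use row[OF \<open>A \<in> set As\<close>] assms(2,3) rep_size in \<open>blast+, simp\<close>)
    then show "time (perm_equiv_tm (A ! i) (A ! j)) \<le> length H * (length H * (2 * n + 5) + 2) + 1"
      using row(1)[OF \<open>A \<in> set As\<close>] assms(2) by simp
  qed
  also have "\<dots> \<le> t_same n"
    unfolding t_same_def l using assms(2-5) by (intro add_mono mult_mono) auto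
  finally show "time (same_class_tm As i j) \<le> t_same n" .
qed

section \<open>Partition of the vertices by keys\<close>

definition is_class :: "('a \<Rightarrow> 'b) \<Rightarrow> 'a list \<Rightarrow> bool" where
  "is_class key C \<longleftrightarrow> C \<noteq> [] \<and> (\<forall>x\<in>set C. key x = key (hd C))"

text \<open>The relation is encoded as equality of keys. The program compares a vertex only with the
  head of a list, and distinct keys of the heads say that no class is split.\<close>

definition classes_ok :: "('a \<Rightarrow> 'b) \<Rightarrow> 'a list list \<Rightarrow> bool" where
  "classes_ok key Cs \<longleftrightarrow> (\<forall>C\<in>set Cs. is_class key C) \<and> distinct (map (\<lambda>C. key (hd C)) Cs)"

lemma classes_ok_Nil: "classes_ok key []"
  and classes_ok_Cons: "classes_ok key (C # Cs) \<longleftrightarrow>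
    is_class key C \<and> key (hd C) \<notin> (\<lambda>C. key (hd C)) ` set Cs \<and> classes_ok key Cs"
  by (auto simp: classes_ok_def)

text \<open>The conjunct on the set of keys is what carries the distinctness through the induction.
  A new member goes behind the head of its list, so the keys of the other heads and of this one stay
  the same.\<close>

lemma insert_vertex_correct:
  assumes "\<And>j. j \<in> set (concat Cs) \<Longrightarrow> val (same_class_tm As i j) \<longleftrightarrow> key i = key j"
    and "\<And>j. j \<in> set (concat Cs) \<Longrightarrow> time (same_class_tm As i j) \<le> T"
    and "classes_ok key Cs"
  shows "classes_ok key (val (insert_vertex_tm As i Cs)) \<and>
    (\<lambda>C. key (hd C)) ` set (val (insert_vertex_tm As i Cs)) = insert (key i) ((\<lambda>C. key (hd C)) ` set Cs) \<and>
    mset (concat (val (insert_vertex_tm As i Cs))) = add_mset i (mset (concat Cs)) \<and>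
    length (val (insert_vertex_tm As i Cs)) \<le> Suc (length Cs) \<and>
    time (insert_vertex_tm As i Cs) \<le> length Cs * (T + 1) + 1"
  using assms
proof (induction As i Cs rule: insert_vertex_tm.induct)
  case (1 As i)
  then show ?case by (simp add: classes_ok_Nil classes_ok_Cons is_class_def)
next
  case (2 As i Cs)
  from 2(4) have False by (simp add: classes_ok_Cons is_class_def)
  then show ?case ..
next
  case (3 As i j C Cs)
  have e: "val (same_class_tm As i j) \<longleftrightarrow> key i = key j" and t: "time (same_class_tm As i j) \<le> T"
    using 3(2)[of j] 3(3)[of j] by auto
  have ok: "is_class key (j # C)" "key j \<notin> (\<lambda>C. key (hd C)) ` set Cs" "classes_ok key Cs"
    using 3(4) by (simp_all add: classes_ok_Cons)
  show ?case
  proof (cases "key i = key j")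
    case True
    have "is_class key (j # i # C)"
      using ok(1) True by (simp add: is_class_def)
    then show ?thesis using True e t ok by (simp add: classes_ok_Cons)
  next
    case False
    define Ds where "Ds = val (insert_vertex_tm As i Cs)"
    have "\<not> val (same_class_tm As i j)" using e False by simp
    then have IH: "classes_ok key Ds"
      "(\<lambda>C. key (hd C)) ` set Ds = insert (key i) ((\<lambda>C. key (hd C)) ` set Cs)"
      "mset (concat Ds) = add_mset i (mset (concat Cs))"
      "length Ds \<le> Suc (length Cs)"
      "time (insert_vertex_tm As i Cs) \<le> length Cs * (T + 1) + 1"
      using 3(1)[OF refl refl _ _ _ ok(3)] 3(2,3) unfolding Ds_def by auto
    then show ?thesis
      using e t False ok by (simp add: classes_ok_Cons Ds_def[symmetric] insert_commute)
  qed
qed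

lemma classes_correct:
  assumes "\<And>i j. i \<in> set is \<Longrightarrow> j \<in> set is \<Longrightarrow> val (same_class_tm As i j) \<longleftrightarrow> key i = key j"
    and "\<And>i j. i \<in> set is \<Longrightarrow> j \<in> set is \<Longrightarrow> time (same_class_tm As i j) \<le> T"
    and "length is \<le> n"
  shows "classes_ok key (val (classes_tm As is)) \<and> mset (concat (val (classes_tm As is))) = mset is \<and>
    length (val (classes_tm As is)) \<le> length is \<and>
    time (classes_tm As is) \<le> length is * (n * (T + 1) + 2) + 1"
  using assms
proof (induction "is")
  case Nil
  then show ?case by (simp add: classes_ok_Nil)
next
  case (Cons i "is")
  define Cs where "Cs = val (classes_tm As is)"
  have IH: "classes_ok key Cs" "mset (concat Cs) = mset is" "length Cs \<le> length is"
      "time (classes_tm As is) \<le> length is * (n * (T + 1) + 2) + 1"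
    using Cons by (simp_all add: Cs_def)
  have "set (concat Cs) = set is" using IH(2) by (metis set_mset_mset)
  then have I: "classes_ok key (val (insert_vertex_tm As i Cs)) \<and>
    (\<lambda>C. key (hd C)) ` set (val (insert_vertex_tm As i Cs)) = insert (key i) ((\<lambda>C. key (hd C)) ` set Cs) \<and>
    mset (concat (val (insert_vertex_tm As i Cs))) = add_mset i (mset (concat Cs)) \<and>
    length (val (insert_vertex_tm As i Cs)) \<le> Suc (length Cs) \<and>
    time (insert_vertex_tm As i Cs) \<le> length Cs * (T + 1) + 1"
    using Cons(2,3) IH(1) by (intro insert_vertex_correct) simp_all
  have "length Cs * (T + 1) \<le> n * (T + 1)"
    using IH(3) Cons(4) by (intro mult_right_mono) auto
  then show ?case
    using I IH by (simp add: Cs_def[symmetric])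
qed

text \<open>Each list is the full class of any of its members: a list containing an equivalent
  vertex has a head with the same key, and distinctness makes it the same list.\<close>

lemma classes_quotient:
  assumes "classes_ok key Cs"
  shows "set ` set Cs = set (concat Cs) // {(i, j). i \<in> set (concat Cs) \<and> j \<in> set (concat Cs) \<and> key i = key j}"
proof -
  define R where "R = {(i, j). i \<in> set (concat Cs) \<and> j \<in> set (concat Cs) \<and> key i = key j}"
  have C: "set C = R `` {x}" if "C \<in> set Cs" "x \<in> set C" for C x
  proof (intro subset_antisym subsetI)
    fix y assume "y \<in> set C"
    then have "key x = key y" using that assms unfolding classes_ok_def is_class_def by metis
    then show "y \<in> R `` {x}" using \<open>y \<in> set C\<close> that by (auto simp: R_def)
  next
    fix y assume "y \<in> R `` {x}"
    then obtain C' where C': "C' \<in> set Cs" "y \<in> set C'" and xy: "key x = key y"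
      by (auto simp: R_def)
    have "key (hd C) = key x" "key (hd C') = key y"
      using that C' assms unfolding classes_ok_def is_class_def by metis+
    then have "C' = C"
      using xy that(1) C'(1) assms unfolding classes_ok_def distinct_map inj_on_def by metis
    then show "y \<in> set C" using C' by simp
  qed
  have "set C \<in> set (concat Cs) // R" if "C \<in> set Cs" for C
  proof -
    have hd: "hd C \<in> set C" using that assms by (simp add: classes_ok_def is_class_def)
    then have "hd C \<in> set (concat Cs)" using that by auto
    then show ?thesis unfolding C[OF that hd] by (rule quotientI)
  qed
  moreover have "X \<in> set ` set Cs" if "X \<in> set (concat Cs) // R" for X
    using that C by (auto elim!: quotientE)
  ultimately show ?thesis unfolding R_def by blast
qed

section \<open>Polynomial bounds\<close>

definition polyb :: "(nat \<Rightarrow> nat) \<Rightarrow> bool" where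
  "polyb f \<longleftrightarrow> (\<exists>p :: nat poly. \<forall>n. f n \<le> poly p n)"

lemma poly_nat_mono: "x \<le> y \<Longrightarrow> poly p x \<le> poly p (y :: nat)"
  by (induction p) (auto intro: add_mono mult_mono)

lemma polyb_const: "polyb (\<lambda>n. c)"
  unfolding polyb_def by (intro exI[of _ "[:c:]"]) simp

lemma polyb_id: "polyb (\<lambda>n. n)"
  unfolding polyb_def by (intro exI[of _ "[:0, 1:]"]) simp

lemma polyb_add: "polyb f \<Longrightarrow> polyb g \<Longrightarrow> polyb (\<lambda>n. f n + g n)"
  unfolding polyb_def by (metis add_mono poly_add)

lemma polyb_mult: "polyb f \<Longrightarrow> polyb g \<Longrightarrow> polyb (\<lambda>n. f n * g n)"
  unfolding polyb_def by (metis mult_le_mono poly_mult)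

lemma polyb_Suc: "polyb f \<Longrightarrow> polyb (\<lambda>n. Suc (f n))"
  using polyb_add[OF _ polyb_const[of 1], of f] by simp

lemma polyb_power2: "polyb f \<Longrightarrow> polyb (\<lambda>n. (f n)\<^sup>2)"
  using polyb_mult[of f f] by (simp add: power2_eq_square)

text \<open>Composition requires the outer polynomial to be monotone, which holds because its
  coefficients are natural numbers.\<close>

lemma polyb_compose:
  assumes "polyb f" "polyb g"
  shows "polyb (\<lambda>n. f (g n))"
proof -
  obtain p q where "f n \<le> poly p n" "g n \<le> poly q n" for n
    using assms unfolding polyb_def by blast
  then have "f (g n) \<le> poly (pcompose p q) n" for n
    unfolding poly_pcompose using poly_nat_mono order_trans by blast
  then show ?thesis unfolding polyb_def by blast
qed

lemmas polyb_intros = polyb_const polyb_id polyb_add polyb_mult polyb_Suc polyb_power2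

lemma polyb_t_reduce: "polyb t_reduce"
  unfolding t_reduce_def by (intro polyb_intros)

lemma polyb_t_rat: "polyb t_rat"
  unfolding t_rat_def by (intro polyb_intros polyb_compose[OF polyb_t_reduce])

lemmas polyb_t_rat_comp = polyb_compose[OF polyb_t_rat]

lemma polyb_t_dist: "polyb t_dist"
  unfolding t_dist_def t_dist_inner_def t_diff_def b_dist_def b_dist_inner_def
  by (intro polyb_intros polyb_t_rat_comp)

lemma polyb_t_step: "polyb t_step"
  unfolding t_step_def t_matrix_def t_R_def b_R_def b_dist_def b_dist_inner_def
    t_A_def t_A_inner_def b_A_def b_A_inner_def b_H_def t_factor_def t_diff_def
  by (intro polyb_intros polyb_t_rat_comp polyb_t_dist)

text \<open>One number that dominates the length of stored entries, the last index m^2 and m itself,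
  so that all costs become functions of one variable.\<close>

definition size_bound :: "nat \<Rightarrow> nat" where
  "size_bound m = bit_bound m (m\<^sup>2) + m\<^sup>2 + m"

lemma polyb_size_bound: "polyb size_bound"
  unfolding size_bound_def bit_bound_def by (intro polyb_intros)

definition t_A1 :: "nat \<Rightarrow> nat" where
  "t_A1 n = 1 + Suc n + (n * (n + 2) + 1) + Suc n * t_step n + Suc n +
     (n * (n * (t_same n + 1) + 2) + 1)"

lemma polyb_t_A1: "polyb t_A1"
  unfolding t_A1_def t_same_def by (intro polyb_intros polyb_t_step)

section \<open>The whole algorithm\<close>

lemma algorithm_A1_correct:
  assumes H: "adjacency_matrix m H"
  shows "output_A1 m H (val (algorithm_A1 H))"
    and "time (algorithm_A1 H) \<le> t_A1 (size_bound m)"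
proof -
  define n where "n = size_bound m"
  have m: "length H = m" and rows: "\<forall>row\<in>set H. length row = length H"
    using H by (auto simp: adjacency_matrix_def)
  have n: "m \<le> n" "m\<^sup>2 \<le> n" "bit_bound (length H) (m\<^sup>2) \<le> n"
    by (simp_all add: n_def size_bound_def m)
  have small: "small n (coeff_A H s i j)" "small n (coeff_R H s i j)" if "s \<le> m\<^sup>2" for s i j
    using small_coeffs[OF that, of H] small_mono n(3) by blast+
  obtain As Rs where AR: "val (tables_tm H m (m\<^sup>2)) = (As, Rs)" by fastforce
  have As: "reps m n (coeff_A H) (Suc (m\<^sup>2)) As"
    and t: "time (tables_tm H m (m\<^sup>2)) \<le> Suc (m\<^sup>2) * t_step n"
    using tables_correct[OF rows small n(2), of "m\<^sup>2"] n(1) AR m by simp_all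
  \<comment> \<open>The key of a vertex is its equivalence class, so equality of keys between
    vertices is the relation itself.\<close>
  define key where "key i = (if i < m then Some (same_class_rel H `` {i}) else None)" for i
  have rel: "(i, j) \<in> same_class_rel H \<longleftrightarrow> i < m \<and> j < m \<and> key i = key j" for i j
  proof -
    have "equiv {..<m} (same_class_rel H)"
      by (rule equivI)
        (auto simp: same_class_rel_def m rows_perm_equiv_iff refl_on_def sym_def trans_def)
    then show ?thesis
      using eq_equiv_class_iff[of "{..<m}" "same_class_rel H" i j] m
      by (auto simp: key_def same_class_rel_def)
  qed
  define Cs where "Cs = val (classes_tm As [0..<m])"
  have "classes_ok key (val (classes_tm As [0..<m])) \<and>
    mset (concat (val (classes_tm As [0..<m]))) = mset [0..<m] \<and>
    length (val (classes_tm As [0..<m])) \<le> length [0..<m] \<and>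
    time (classes_tm As [0..<m]) \<le> length [0..<m] * (n * (t_same n + 1) + 2) + 1"
    using same_class_correct[of H n As] As n m rel
    by (intro classes_correct) (auto simp: m)
  then have Cs: "classes_ok key Cs" "mset (concat Cs) = mset [0..<m]"
    and tC: "time (classes_tm As [0..<m]) \<le> m * (n * (t_same n + 1) + 2) + 1"
    by (simp_all add: Cs_def)
  have set: "set (concat Cs) = {..<m}"
    using Cs(2) by (metis set_mset_mset set_upt atLeast0LessThan)
  have "set ` set Cs = {..<m} // same_class_rel H"
  proof -
    have "same_class_rel H = {(i, j). i \<in> {..<m} \<and> j \<in> {..<m} \<and> key i = key j}"
      using rel by auto
    then show ?thesis using classes_quotient[OF Cs(1)] by (simp only: set)
  qed
  moreover have "distinct (concat Cs)"
    using Cs(2) by (metis distinct_upt mset_eq_imp_distinct_iff)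
  moreover have "map (map (map rat_of_brat)) As =
      map (\<lambda>s. map (\<lambda>i. map (\<lambda>j. coeff_A H s i j) [0..<m]) [0..<m]) [0..<m\<^sup>2 + 1]"
  proof (rule nth_equalityI)
    show "length (map (map (map rat_of_brat)) As) = length (map (\<lambda>s. map (\<lambda>i. map (\<lambda>j. coeff_A H s i j)
        [0..<m]) [0..<m]) [0..<m\<^sup>2 + 1])"
      using As by (simp add: reps_def)
    fix t assume "t < length (map (map (map rat_of_brat)) As)"
    then have t: "t < Suc (m\<^sup>2)" "t < length As" using As by (simp_all add: reps_def)
    have "map (map rat_of_brat) (As ! t) = map (\<lambda>i. map (coeff_A H t i) [0..<m]) [0..<m]"
      using As t reps_row[OF As t(1)] by (intro nth_equalityI) (simp_all add: reps_def)
    then show "map (map (map rat_of_brat)) As ! t = map (\<lambda>s. map (\<lambda>i. map (\<lambda>j. coeff_A H s i j)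
        [0..<m]) [0..<m]) [0..<m\<^sup>2 + 1] ! t"
      using t by (simp del: upt_Suc)
  qed
  ultimately show "output_A1 m H (val (algorithm_A1 H))"
    by (simp add: output_A1_def algorithm_A1_def m AR[unfolded power2_eq_square] Cs_def power2_eq_square)
  have "time (algorithm_A1 H) = 1 + Suc m + (m * (m + 2) + 1) + time (tables_tm H m (m\<^sup>2)) + Suc m +
      time (classes_tm As [0..<m])"
    by (simp add: algorithm_A1_def m AR[unfolded power2_eq_square] power2_eq_square)
  also have "\<dots> \<le> 1 + Suc m + (m * (m + 2) + 1) + Suc (m\<^sup>2) * t_step n + Suc m +
      (m * (n * (t_same n + 1) + 2) + 1)"
    using t tC by linarith
  also have "\<dots> \<le> t_A1 n"
    unfolding t_A1_def using n by (intro add_mono mult_mono) auto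
  finally show "time (algorithm_A1 H) \<le> t_A1 (size_bound m)" by (simp only: n_def)
qed

theorem theorem6:
  shows "\<exists>p :: nat poly. \<forall>m H. adjacency_matrix m H \<longrightarrow>
    output_A1 m H (val (algorithm_A1 H)) \<and> time (algorithm_A1 H) \<le> poly p m"
proof -
  obtain p where p: "\<And>m. t_A1 (size_bound m) \<le> poly p m"
    using polyb_compose[OF polyb_t_A1 polyb_size_bound] by (auto simp: polyb_def)
  show ?thesis
  proof (intro exI[of _ p] allI impI conjI)
    fix m H assume H: "adjacency_matrix m H"
    show "output_A1 m H (val (algorithm_A1 H))" using H by (rule algorithm_A1_correct)
    show "time (algorithm_A1 H) \<le> poly p m"
      using algorithm_A1_correct(2)[OF H] p by (rule order_trans)
  qed
qed

end
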